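(* Let $(U(t,s))_{t\ge s}$ be an evolution family on a real separable Hilbert space $\mathbb{H}$, and let $(\mu_{t,s})_{t\ge s}$ be infinitely divisible probability measures on $\mathbb{H}$, $\mu_{t,s}=[a_{t,s},R_{t,s},m_{t,s}]$, with $\mu_{t,s}=\mu_{t,r}*(\mu_{r,s}\circ U(t,r)^{-1})$ for all $t\ge r\ge s$. Let $p_{s,t}f(x)=\int_{\mathbb{H}}f(U(t,s)x+y)\,\mu_{t,s}(dy)$, $\Gamma_{t,s}=R_{t,s}^{-1/2}U(t,s)$, and let $(\nu_t)_{t\in\mathbb{R}}$ be an evolution system of measures for $(p_{s,t})_{t\ge s}$. For $s\le t$, $\alpha>1$, $\varepsilon>0$ let $$C_{s,t}(\alpha,\varepsilon)=\int_{\mathbb{H}}\Bigl[\int_{\mathbb{H}}\exp\Bigl(-\frac{\alpha|\Gamma_{t,s}(x-y)|^2}{2(\alpha-1)}\Bigr)\nu_s(dy)\Bigr]^{-(1+\varepsilon)}\nu_s(dx).$$ Then for every bounded Borel function $f$ on $\mathbb{H}$, $$\|p_{s,t}f\|_{L^{\alpha(1+\varepsilon)}(\mathbb{H},\nu_s)}\le C_{s,t}(\alpha,\varepsilon)^{\frac{1}{\alpha(1+\varepsilon)}}\,\|f\|_{L^\alpha(\mathbb{H},\nu_t)}.$$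
   Context: Evolution family: bounded linear operators $U(t,s)$, $t\ge s$, on $\mathbb{H}$ with $U(s,s)=I$, $U(t,r)U(r,s)=U(t,s)$ for $t\ge r\ge s$, and $(t,s)\mapsto U(t,s)x$ continuous for each $x$. $\mu=[a,R,m]$ means that $\mu$ is infinitely divisible with $\int e^{i\langle x,\xi\rangle}\mu(dx)=e^{-\psi(\xi)}$, $\psi(\xi)=-i\langle a,\xi\rangle+\frac12\langle R\xi,\xi\rangle-\int_{\mathbb{H}}\bigl(e^{i\langle\xi,x\rangle}-1-\frac{i\langle\xi,x\rangle}{1+|x|^2}\bigr)m(dx)$, where $a\in\mathbb{H}$, $R$ is a non-negative symmetric trace class operator and $m$ is a Lévy measure. $R_{t,s}^{-1/2}$ is the pseudo-inverse of $R_{t,s}^{1/2}$, and $|\Gamma_{t,s}x|:=\infty$ (with $e^{-\infty}=0$) if $U(t,s)x\notin R_{t,s}^{1/2}(\mathbb{H})$. If $C_{s,t}(\alpha,\varepsilon)=\infty$ the right-hand side of the bound is read as $+\infty$. An evolution system of measures for $(p_{s,t})_{t\ge s}$ is a family of Borel probability measures $(\nu_t)_{t\in\mathbb{R}}$ on $\mathbb{H}$ with $\int_{\mathbb{H}}p_{s,t}f\,d\nu_s=\int_{\mathbb{H}}f\,d\nu_t$ for all $s\le t$ and all bounded Borel $f$. *)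

theory Defs
  imports "HOL-Probability.Probability"
begin

text \<open>
  Real separable Hilbert spaces are types of sort
  \<open>{real_inner, banach, second_countable_topology}\<close>; bounded operators are of type
  \<open>'a \<Rightarrow>\<^sub>L 'a\<close>. Two-parameter families are indexed by all pairs of reals, but only the values at
  \<open>(t, s)\<close> with \<open>s \<le> t\<close> are ever constrained or used.
\<close>

definition nonneg_symmetric :: "('a::real_inner \<Rightarrow>\<^sub>L 'a) \<Rightarrow> bool" where
  "nonneg_symmetric R \<longleftrightarrow>
     (\<forall>x y. blinfun_apply R x \<bullet> y = x \<bullet> blinfun_apply R y) \<and>
     (\<forall>x. 0 \<le> blinfun_apply R x \<bullet> x)"

definition orthonormal_basis :: "'a::real_inner set \<Rightarrow> bool" where
  "orthonormal_basis E \<longleftrightarrow>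
     pairwise orthogonal E \<and> (\<forall>e\<in>E. norm e = 1) \<and> closure (span E) = UNIV"

text \<open>
  For a non-negative symmetric operator \<open>R\<close> one has \<open>\<bar>R\<bar> = R\<close>, so that \<open>R\<close> is trace class iff
  its trace \<open>\<Sum>e\<in>E. \<langle>R e, e\<rangle>\<close> is finite; this does not depend on the orthonormal basis \<open>E\<close>.
\<close>

definition nonneg_symmetric_trace_class :: "('a::real_inner \<Rightarrow>\<^sub>L 'a) \<Rightarrow> bool" where
  "nonneg_symmetric_trace_class R \<longleftrightarrow>
     nonneg_symmetric R \<and>
     (\<exists>E. orthonormal_basis E \<and> (\<lambda>e. blinfun_apply R e \<bullet> e) summable_on E)"

text \<open>
  On a Hilbert space a non-negative symmetric bounded operator has exactly one such square root.
\<close>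

definition op_sqrt :: "('a::real_inner \<Rightarrow>\<^sub>L 'a) \<Rightarrow> ('a \<Rightarrow>\<^sub>L 'a)" where
  "op_sqrt R = (SOME S. nonneg_symmetric S \<and> S o\<^sub>L S = R)"

text \<open>
  The inverse of the restriction of \<open>S\<close> to the orthogonal complement of its kernel, meaningful
  only for \<open>z\<close> in the range of \<open>S\<close>. The value is the preimage of \<open>z\<close> of minimal norm.
\<close>

definition pseudo_inverse :: "('a::real_inner \<Rightarrow>\<^sub>L 'a) \<Rightarrow> 'a \<Rightarrow> 'a" where
  "pseudo_inverse S z =
     (THE x. blinfun_apply S x = z \<and> (\<forall>y. blinfun_apply S y = 0 \<longrightarrow> orthogonal x y))"

definition evolution_family ::
  "(real \<Rightarrow> real \<Rightarrow> ('a::real_inner \<Rightarrow>\<^sub>L 'a)) \<Rightarrow> bool" where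
  "evolution_family U \<longleftrightarrow>
     (\<forall>s. U s s = id_blinfun) \<and>
     (\<forall>s r t. s \<le> r \<and> r \<le> t \<longrightarrow> U t r o\<^sub>L U r s = U t s) \<and>
     (\<forall>x. continuous_on {(t, s). s \<le> t} (\<lambda>(t, s). blinfun_apply (U t s) x))"

definition borel_prob :: "'a::topological_space measure \<Rightarrow> bool" where
  "borel_prob M \<longleftrightarrow> prob_space M \<and> sets M = sets borel"

text \<open>
  The constant \<open>convolution\<close> of HOL-Probability is restricted to ordered Euclidean spaces;
  this is the same definition on a general normed space.
\<close>

definition conv :: "'a::real_normed_vector measure \<Rightarrow> 'a measure \<Rightarrow> 'a measure" where
  "conv M N = distr (M \<Otimes>\<^sub>M N) borel (\<lambda>(x, y). x + y)"

primrec conv_power :: "nat \<Rightarrow> 'a::real_normed_vector measure \<Rightarrow> 'a measure" where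
  "conv_power 0 M = return borel 0"
| "conv_power (Suc n) M = conv M (conv_power n M)"

definition infinitely_divisible :: "'a::real_normed_vector measure \<Rightarrow> bool" where
  "infinitely_divisible M \<longleftrightarrow>
     borel_prob M \<and> (\<forall>n\<ge>1. \<exists>N. borel_prob N \<and> M = conv_power n N)"

definition levy_measure :: "'a::real_inner measure \<Rightarrow> bool" where
  "levy_measure m \<longleftrightarrow>
     sets m = sets borel \<and> emeasure m {0} = 0 \<and>
     (\<integral>\<^sup>+x. ennreal (min 1 ((norm x)\<^sup>2)) \<partial>m) < \<infinity>"

definition levy_exponent ::
  "'a::real_inner \<Rightarrow> ('a \<Rightarrow>\<^sub>L 'a) \<Rightarrow> 'a measure \<Rightarrow> 'a \<Rightarrow> complex" where
  "levy_exponent a R m \<xi> =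
     - \<i> * complex_of_real (a \<bullet> \<xi>)
     + complex_of_real (blinfun_apply R \<xi> \<bullet> \<xi>) / 2
     - (\<integral>x. (exp (\<i> * complex_of_real (\<xi> \<bullet> x)) - 1
              - \<i> * complex_of_real (\<xi> \<bullet> x) / complex_of_real (1 + (norm x)\<^sup>2)) \<partial>m)"

text \<open>The relation \<open>\<mu> = [a, R, m]\<close>.\<close>

definition has_triplet ::
  "'a::real_inner measure \<Rightarrow> 'a \<Rightarrow> ('a \<Rightarrow>\<^sub>L 'a) \<Rightarrow> 'a measure \<Rightarrow> bool" where
  "has_triplet \<mu> a R m \<longleftrightarrow>
     infinitely_divisible \<mu> \<and> nonneg_symmetric_trace_class R \<and> levy_measure m \<and>
     (\<forall>\<xi>. (\<integral>x. exp (\<i> * complex_of_real (x \<bullet> \<xi>)) \<partial>\<mu>) = exp (- levy_exponent a R m \<xi>))"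

definition trans_op ::
  "(real \<Rightarrow> real \<Rightarrow> ('a::real_normed_vector \<Rightarrow>\<^sub>L 'a)) \<Rightarrow> (real \<Rightarrow> real \<Rightarrow> 'a measure) \<Rightarrow>
   real \<Rightarrow> real \<Rightarrow> ('a \<Rightarrow> real) \<Rightarrow> 'a \<Rightarrow> real" where
  "trans_op U \<mu> s t f x = (\<integral>y. f (blinfun_apply (U t s) x + y) \<partial>\<mu> t s)"

definition evolution_system_of_measures ::
  "(real \<Rightarrow> real \<Rightarrow> ('a \<Rightarrow> real) \<Rightarrow> 'a \<Rightarrow> real) \<Rightarrow>
   (real \<Rightarrow> 'a::topological_space measure) \<Rightarrow> bool" where
  "evolution_system_of_measures p \<nu> \<longleftrightarrow>
     (\<forall>t. borel_prob (\<nu> t)) \<and>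
     (\<forall>s t f. s \<le> t \<and> f \<in> borel_measurable borel \<and> bounded (range f) \<longrightarrow>
        (\<integral>x. p s t f x \<partial>\<nu> s) = (\<integral>x. f x \<partial>\<nu> t))"

text \<open>
  \<open>x\<^sup>p\<close> for exponents \<open>p > 0\<close>. Negative powers are written as \<open>inverse (epowr x p)\<close>,
  where \<open>inverse 0 = \<infinity>\<close> and \<open>inverse \<infinity> = 0\<close> on \<open>ennreal\<close>.
\<close>

definition epowr :: "ennreal \<Rightarrow> real \<Rightarrow> ennreal" where
  "epowr x p = (if x = \<infinity> then \<infinity> else ennreal (enn2real x powr p))"

text \<open>\<open>e\<^sup>-\<^sup>c\<close> with \<open>e\<^sup>-\<^sup>\<infinity> = 0\<close>.\<close>

definition exp_neg :: "ennreal \<Rightarrow> ennreal" where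
  "exp_neg c = (if c = \<infinity> then 0 else ennreal (exp (- enn2real c)))"

definition Lp_norm :: "real \<Rightarrow> 'a measure \<Rightarrow> ('a \<Rightarrow> real) \<Rightarrow> ennreal" where
  "Lp_norm p M f = epowr (\<integral>\<^sup>+x. ennreal (\<bar>f x\<bar> powr p) \<partial>M) (1 / p)"

text \<open>\<open>\<bar>\<Gamma>\<^sub>t\<^sub>,\<^sub>s x\<bar>\<close> as an extended real, where \<open>V\<close> and \<open>R\<close> stand for \<open>U t s\<close> and \<open>R t s\<close>.\<close>

definition Gamma_norm :: "('a::real_inner \<Rightarrow>\<^sub>L 'a) \<Rightarrow> ('a \<Rightarrow>\<^sub>L 'a) \<Rightarrow> 'a \<Rightarrow> ennreal" where
  "Gamma_norm V R x =
     (if blinfun_apply V x \<in> range (blinfun_apply (op_sqrt R))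
      then ennreal (norm (pseudo_inverse (op_sqrt R) (blinfun_apply V x)))
      else \<infinity>)"

definition C_const ::
  "(real \<Rightarrow> real \<Rightarrow> ('a::real_inner \<Rightarrow>\<^sub>L 'a)) \<Rightarrow> (real \<Rightarrow> real \<Rightarrow> ('a \<Rightarrow>\<^sub>L 'a)) \<Rightarrow>
   (real \<Rightarrow> 'a measure) \<Rightarrow> real \<Rightarrow> real \<Rightarrow> real \<Rightarrow> real \<Rightarrow> ennreal" where
  "C_const U R \<nu> s t \<alpha> \<epsilon> =
     (\<integral>\<^sup>+x. inverse (epowr
        (\<integral>\<^sup>+y. exp_neg (ennreal (\<alpha> / (2 * (\<alpha> - 1))) * (Gamma_norm (U t s) (R t s) (x - y))\<^sup>2) \<partial>\<nu> s)
        (1 + \<epsilon>)) \<partial>\<nu> s)"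

end

theory Submission
  imports Defs
begin

text \<open>
  The theorem is an integrated Harnack inequality. For bounded \<open>f \<ge> 0\<close> and all \<open>x\<close>, \<open>y\<close>,
  \<open>(p f(x))\<^sup>\<alpha> exp (- \<alpha> \<bar>\<Gamma> (x - y)\<bar>\<^sup>2 / (2 (\<alpha> - 1))) \<le> p (f\<^sup>\<alpha>)(y)\<close>, where \<open>p\<close>, \<open>\<Gamma>\<close> and \<open>U\<close> belong to the
  fixed pair \<open>s \<le> t\<close>.
  Integrating in \<open>y\<close> against \<open>\<nu>\<^sub>s\<close> turns the right-hand side into \<open>N = \<integral> f\<^sup>\<alpha> d\<nu>\<^sub>t\<close>, because \<open>\<nu>\<close> is
  an evolution system of measures, and the left-hand side into \<open>(p f(x))\<^sup>\<alpha> I(x)\<close>, where \<open>I(x)\<close>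
  is the inner integral of the constant \<open>C\<close>. Raising
  \<open>(p f(x))\<^sup>\<alpha> \<le> N / I(x)\<close> to the power \<open>1 + \<epsilon>\<close> and integrating in \<open>x\<close> gives the bound.

  The Harnack inequality compares \<open>\<mu> = [a, R, m]\<close> with its translate by \<open>h = U (x - y)\<close>. If
  \<open>h = R\<^sup>1\<^sup>/\<^sup>2 k\<close>, put \<open>c = \<bar>k\<bar>\<close> and \<open>v = R\<^sup>1\<^sup>/\<^sup>2 (k / \<bar>k\<bar>)\<close>, so that \<open>h = c v\<close>. By
  Cauchy--Schwarz \<open>\<langle>\<xi>, v\<rangle>\<^sup>2 \<le> \<langle>R \<xi>, \<xi>\<rangle>\<close>, so a one-dimensional Gaussian along \<open>v\<close> can be split off:
  formally \<open>\<mu>\<close> is the law of \<open>X + g v\<close> with \<open>g\<close> standard normal and independent of \<open>X\<close>, and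
  translating by \<open>h\<close> replaces \<open>g\<close> by \<open>g + c\<close>. The density of \<open>g + c\<close> with respect to \<open>g\<close> is
  \<open>\<rho>(u) = exp (c u - c\<^sup>2 / 2)\<close>, and Young's inequality together with the explicit moments
  of \<open>\<rho>\<close> produces exactly the exponential above.

  A random element \<open>X\<close> as above exists, but constructing its law means constructing an infinitely
  divisible measure on a Hilbert space. This is avoided as follows. What the argument
  uses of the law of \<open>X\<close> is that integration against it is positive on trigonometric polynomials.
  On these, the integral is expressed by the characteristic function \<open>\<phi>\<close> alone, so the property can
  be stated as \<open>trig_positive \<phi>\<close>. The functions with this property
  contain all characteristic functions of finite measures and are closed under sums, products,
  exponentials and pointwise limits, which suffices to reach \<open>\<phi>\<close> from its formula
  (\<open>has_triplet_gaussian_split\<close>). The price is that the inequality is at first available only for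
  trigonometric polynomials (\<open>shift_inequality_trig\<close>). It extends to continuous
  functions of trigonometric polynomials by the Weierstrass theorem, and to bounded Borel functions
  by density of trigonometric polynomials in \<open>L\<^sup>1\<close> (\<open>shift_inequality_borel\<close>).
\<close>

section \<open>Square roots of non-negative operators\<close>

lemma nonneg_symmetric_Cauchy_Schwarz:
  fixes A :: "'a::real_inner \<Rightarrow>\<^sub>L 'a"
  assumes "nonneg_symmetric A"
  shows "(A x \<bullet> y)\<^sup>2 \<le> (A x \<bullet> x) * (A y \<bullet> y)"
proof -
  have sym: "A u \<bullet> w = A w \<bullet> u" and pos: "0 \<le> A u \<bullet> u" for u w
    using assms by (auto simp: nonneg_symmetric_def inner_commute)
  \<comment> \<open>non-negativity at \<open>x + r y\<close>, a quadratic polynomial in \<open>r\<close>\<close>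
  have quad: "0 \<le> A x \<bullet> x + 2 * r * (A x \<bullet> y) + r\<^sup>2 * (A y \<bullet> y)" for r
    using pos[of "x + r *\<^sub>R y"] sym[of y x]
    by (simp add: blinfun.add_right blinfun.scaleR_right inner_add_left inner_add_right
        power2_eq_square algebra_simps)
  show ?thesis
  proof (cases "A y \<bullet> y = 0")
    case True
    have "A x \<bullet> y = 0"
    proof (rule ccontr)
      assume *: "A x \<bullet> y \<noteq> 0"
      show False
        using quad[of "- (A x \<bullet> x + 1) / (2 * (A x \<bullet> y))"] * True by (simp add: field_simps)
    qed
    then show ?thesis using True by simp
  next
    case False
    then have "0 < A y \<bullet> y" using pos[of y] by simp
    then show ?thesis
      using quad[of "- (A x \<bullet> y) / (A y \<bullet> y)"]
      by (simp add: power2_eq_square field_simps)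
  qed
qed

lemma nonneg_symmetric_norm_le_1:
  fixes A :: "'a::real_inner \<Rightarrow>\<^sub>L 'a"
  assumes "nonneg_symmetric A" and le: "\<And>x. A x \<bullet> x \<le> x \<bullet> x"
  shows "norm A \<le> 1"
proof (rule norm_blinfun_bound)
  fix x
  let ?y = "A x"
  have "(?y \<bullet> ?y)\<^sup>2 \<le> (A x \<bullet> x) * (A ?y \<bullet> ?y)"
    by (rule nonneg_symmetric_Cauchy_Schwarz[OF assms(1)])
  also have "\<dots> \<le> (x \<bullet> x) * (?y \<bullet> ?y)"
  proof (rule mult_mono)
    show "0 \<le> A ?y \<bullet> ?y" using assms(1) unfolding nonneg_symmetric_def by blast
  qed (use le in auto)
  finally have "(?y \<bullet> ?y) * (?y \<bullet> ?y) \<le> (x \<bullet> x) * (?y \<bullet> ?y)"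
    by (simp add: power2_eq_square)
  then have "?y \<bullet> ?y \<le> x \<bullet> x"
    by (cases "?y = 0") (auto simp: mult_le_cancel_right)
  then show "norm (A x) \<le> 1 * norm x"
    by (simp add: norm_eq_sqrt_inner)
qed simp

text \<open>
  The recursion \<open>Y \<mapsto> (A + Y\<^sup>2) / 2\<close> is chosen because its fixed points solve \<open>(1 - Y)\<^sup>2 = 1 - A\<close>,
  so a limit yields a square root of \<open>1 - A\<close>.
\<close>

primrec sqrt_iter :: "('a::real_normed_vector \<Rightarrow>\<^sub>L 'a) \<Rightarrow> nat \<Rightarrow> ('a \<Rightarrow>\<^sub>L 'a)" where
  "sqrt_iter A 0 = 0"
| "sqrt_iter A (Suc n) = (1/2) *\<^sub>R (A + (sqrt_iter A n o\<^sub>L sqrt_iter A n))"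

text \<open>
  The same recursion for \<open>A = 1\<close> in the reals. It increases and stays below 1; its
  increments majorise those of the operator recursion, also in the critical case \<open>\<parallel>A\<parallel> = 1\<close> where the
  recursion is not a strict contraction.
\<close>

primrec sqrt_iter_real :: "nat \<Rightarrow> real" where
  "sqrt_iter_real 0 = 0"
| "sqrt_iter_real (Suc n) = (1 + (sqrt_iter_real n)\<^sup>2) / 2"

lemma sqrt_iter_real_bounds: "0 \<le> sqrt_iter_real n \<and> sqrt_iter_real n \<le> 1"
proof (induction n)
  case (Suc n)
  then have "(sqrt_iter_real n)\<^sup>2 \<le> 1"
    by (simp add: power_le_one)
  then show ?case by simp
qed simp

lemma sqrt_iter_real_le_Suc: "sqrt_iter_real n \<le> sqrt_iter_real (Suc n)"
proof -
  have "0 \<le> (1 - sqrt_iter_real n)\<^sup>2" by simp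
  then show ?thesis by (simp add: power2_diff)
qed

lemma norm_sqrt_iter_le:
  assumes "norm A \<le> 1"
  shows "norm (sqrt_iter A n) \<le> sqrt_iter_real n"
proof (induction n)
  case (Suc n)
  have "norm (sqrt_iter A n o\<^sub>L sqrt_iter A n) \<le> norm (sqrt_iter A n) * norm (sqrt_iter A n)"
    by (rule norm_blinfun_compose)
  also have "\<dots> \<le> (sqrt_iter_real n)\<^sup>2"
    unfolding power2_eq_square using Suc sqrt_iter_real_bounds[of n] by (intro mult_mono) auto
  finally have "norm (A + (sqrt_iter A n o\<^sub>L sqrt_iter A n)) \<le> 1 + (sqrt_iter_real n)\<^sup>2"
    using assms norm_triangle_ineq[of A "sqrt_iter A n o\<^sub>L sqrt_iter A n"] by simp
  then show ?case by simp
qed simp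

text \<open>
  By the identity \<open>Y\<^sup>2 - Z\<^sup>2 = Y (Y - Z) + (Y - Z) Z\<close>, valid for non-commuting operators, both
  sides satisfy the same recursion up to the triangle inequality.
\<close>

lemma norm_sqrt_iter_Suc_diff_le:
  assumes "norm A \<le> 1"
  shows "norm (sqrt_iter A (Suc n) - sqrt_iter A n) \<le> sqrt_iter_real (Suc n) - sqrt_iter_real n"
proof (induction n)
  case 0
  show ?case using assms by simp
next
  case (Suc n)
  let ?Y = "sqrt_iter A (Suc n)" and ?Z = "sqrt_iter A n"
  let ?y = "sqrt_iter_real (Suc n)" and ?z = "sqrt_iter_real n"
  have "sqrt_iter A (Suc (Suc n)) - ?Y
      = (1/2) *\<^sub>R (A + (?Y o\<^sub>L ?Y)) - (1/2) *\<^sub>R (A + (?Z o\<^sub>L ?Z))"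
    by (metis sqrt_iter.simps(2))
  also have "\<dots> = (1/2) *\<^sub>R ((?Y o\<^sub>L (?Y - ?Z)) + ((?Y - ?Z) o\<^sub>L ?Z))"
    by (simp add: bounded_bilinear.diff_left[OF bounded_bilinear_blinfun_compose]
        bounded_bilinear.diff_right[OF bounded_bilinear_blinfun_compose] scaleR_right_diff_distrib
        scaleR_right_distrib del: sqrt_iter.simps)
  finally have eq: "sqrt_iter A (Suc (Suc n)) - ?Y = \<dots>" .
  have "norm (?Y o\<^sub>L (?Y - ?Z)) \<le> ?y * (?y - ?z)"
    by (rule order_trans[OF norm_blinfun_compose])
      (intro mult_mono norm_sqrt_iter_le assms Suc.IH, use sqrt_iter_real_bounds in auto)
  moreover have "norm ((?Y - ?Z) o\<^sub>L ?Z) \<le> (?y - ?z) * ?z"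
    by (rule order_trans[OF norm_blinfun_compose])
      (intro mult_mono norm_sqrt_iter_le assms Suc.IH,
        use sqrt_iter_real_le_Suc[of n] in \<open>auto simp del: sqrt_iter_real.simps\<close>)
  ultimately have "norm ((?Y o\<^sub>L (?Y - ?Z)) + ((?Y - ?Z) o\<^sub>L ?Z)) \<le> ?y * (?y - ?z) + (?y - ?z) * ?z"
    using norm_triangle_ineq add_mono order_trans by metis
  also have "\<dots> = ?y\<^sup>2 - ?z\<^sup>2"
    by (simp only: power2_eq_square) algebra
  finally have "norm (sqrt_iter A (Suc (Suc n)) - ?Y) \<le> (?y\<^sup>2 - ?z\<^sup>2) / 2"
    unfolding eq by (simp del: sqrt_iter.simps sqrt_iter_real.simps)
  also have "\<dots> = sqrt_iter_real (Suc (Suc n)) - ?y"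
    by (simp only: sqrt_iter_real.simps) (simp add: field_simps)
  finally show ?case .
qed

lemma convergent_sqrt_iter:
  fixes A :: "'a::banach \<Rightarrow>\<^sub>L 'a"
  assumes "norm A \<le> 1"
  shows "convergent (sqrt_iter A)"
proof -
  have "convergent sqrt_iter_real"
  proof (rule Bseq_mono_convergent)
    show "Bseq sqrt_iter_real" using sqrt_iter_real_bounds by (intro BseqI'[of _ 1]) auto
    show "\<forall>m. \<forall>n\<ge>m. sqrt_iter_real m \<le> sqrt_iter_real n"
      using lift_Suc_mono_le[of sqrt_iter_real, OF sqrt_iter_real_le_Suc] by blast
  qed
  then have "summable (\<lambda>n. sqrt_iter_real (Suc n) - sqrt_iter_real n)"
    using telescope_summable convergent_def by blast
  then have "summable (\<lambda>n. sqrt_iter A (Suc n) - sqrt_iter A n)"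
    by (rule summable_comparison_test'[of _ 0]) (rule norm_sqrt_iter_Suc_diff_le[OF assms])
  then have "convergent (\<lambda>n. \<Sum>i<n. sqrt_iter A (Suc i) - sqrt_iter A i)"
    by (simp add: summable_iff_convergent)
  then show ?thesis by (simp add: sum_lessThan_telescope del: sqrt_iter.simps(2))
qed

lemma sqrt_iter_symmetric:
  fixes A :: "'a::real_inner \<Rightarrow>\<^sub>L 'a"
  assumes "\<And>x y. A x \<bullet> y = x \<bullet> A y"
  shows "sqrt_iter A n x \<bullet> y = x \<bullet> sqrt_iter A n y"
  by (induction n arbitrary: x y)
    (simp_all add: assms plus_blinfun.rep_eq scaleR_blinfun.rep_eq inner_add_left inner_add_right)

text \<open>
  Applying the recursion to \<open>A = 1 - R / \<parallel>R\<parallel>\<close>, which satisfies \<open>0 \<le> A \<le> 1\<close> as a quadratic form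
  and hence \<open>\<parallel>A\<parallel> \<le> 1\<close>, gives \<open>Y\<close> with \<open>(1 - Y)\<^sup>2 = R / \<parallel>R\<parallel>\<close> and \<open>\<parallel>Y\<parallel> \<le> 1\<close>; the norm bound makes
  \<open>1 - Y\<close> non-negative.
\<close>

lemma nonneg_symmetric_sqrt_exists:
  fixes R :: "'a::{real_inner, banach} \<Rightarrow>\<^sub>L 'a"
  assumes R: "nonneg_symmetric R"
  shows "\<exists>S. nonneg_symmetric S \<and> S o\<^sub>L S = R"
proof (cases "R = 0")
  case True
  then show ?thesis by (intro exI[of _ 0]) (auto simp: nonneg_symmetric_def)
next
  case False
  define c where "c = norm R"
  have c: "c > 0" using False by (simp add: c_def)
  define A where "A = id_blinfun - (1 / c) *\<^sub>R R"
  have A: "A x = x - (1 / c) *\<^sub>R R x" for x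
    by (simp add: A_def minus_blinfun.rep_eq scaleR_blinfun.rep_eq)
  have symR: "R x \<bullet> y = x \<bullet> R y" and posR: "0 \<le> R x \<bullet> x" for x y
    using R by (auto simp: nonneg_symmetric_def)
  have "R x \<bullet> x \<le> c * (x \<bullet> x)" for x
  proof -
    have "R x \<bullet> x \<le> norm (R x) * norm x" by (rule norm_cauchy_schwarz)
    also have "\<dots> \<le> (c * norm x) * norm x"
      unfolding c_def by (intro mult_right_mono norm_blinfun) auto
    finally show ?thesis by (simp add: dot_square_norm power2_eq_square mult.assoc)
  qed
  then have posA: "0 \<le> A x \<bullet> x" for x
    using c by (simp add: A inner_diff_left field_simps)
  have symA: "A x \<bullet> y = x \<bullet> A y" for x y
    by (simp add: A inner_diff_left inner_diff_right symR)
  have "A x \<bullet> x \<le> x \<bullet> x" for x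
    using c posR[of x] by (simp add: A inner_diff_left)
  then have nA: "norm A \<le> 1"
    using posA symA by (intro nonneg_symmetric_norm_le_1) (auto simp: nonneg_symmetric_def)
  obtain Y where Y: "sqrt_iter A \<longlonglongrightarrow> Y"
    using convergent_sqrt_iter[OF nA] by (auto simp: convergent_def)
  have "(\<lambda>n. (1/2) *\<^sub>R (A + (sqrt_iter A n o\<^sub>L sqrt_iter A n))) \<longlonglongrightarrow> (1/2) *\<^sub>R (A + (Y o\<^sub>L Y))"
    by (intro tendsto_intros bounded_bilinear.tendsto[OF bounded_bilinear_blinfun_compose] Y)
  then have "(\<lambda>n. sqrt_iter A (Suc n)) \<longlonglongrightarrow> (1/2) *\<^sub>R (A + (Y o\<^sub>L Y))" by simp
  from LIMSEQ_unique[OF LIMSEQ_Suc[OF Y] this] have Yeq: "Y = (1/2) *\<^sub>R (A + (Y o\<^sub>L Y))" .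
  have "norm (sqrt_iter A n) \<le> 1" for n
    using norm_sqrt_iter_le[OF nA, of n] sqrt_iter_real_bounds[of n] by linarith
  then have nY: "norm Y \<le> 1"
    by (intro LIMSEQ_le_const2[OF tendsto_norm[OF Y]]) auto
  have Yx: "(\<lambda>n. sqrt_iter A n x) \<longlonglongrightarrow> Y x" for x
    by (intro blinfun.tendsto Y tendsto_const)
  have symY: "Y x \<bullet> y = x \<bullet> Y y" for x y
    using LIMSEQ_unique[OF tendsto_inner[OF Yx tendsto_const] 
        tendsto_inner[OF tendsto_const Yx, of x y, folded sqrt_iter_symmetric[OF symA]]] .
  have leY: "Y x \<bullet> x \<le> x \<bullet> x" for x
  proof -
    have "Y x \<bullet> x \<le> norm (Y x) * norm x" by (rule norm_cauchy_schwarz)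
    also have "\<dots> \<le> (1 * norm x) * norm x"
      by (intro mult_right_mono order_trans[OF norm_blinfun] nY) auto
    finally show ?thesis by (simp add: dot_square_norm power2_eq_square)
  qed
  define S where "S = sqrt c *\<^sub>R (id_blinfun - Y)"
  have S: "S x = sqrt c *\<^sub>R (x - Y x)" for x
    by (simp add: S_def minus_blinfun.rep_eq scaleR_blinfun.rep_eq)
  have "S (S x) = R x" for x
  proof -
    have "2 *\<^sub>R Y x = A x + Y (Y x)"
      by (subst Yeq) (simp add: plus_blinfun.rep_eq scaleR_blinfun.rep_eq)
    then have "x - Y x - Y (x - Y x) = x - A x"
      by (simp add: blinfun.diff_right scaleR_2 algebra_simps)
    then show ?thesis using c
      by (simp add: S A blinfun.scaleR_right)
  qed
  moreover have "nonneg_symmetric S"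
    using leY c symY by (auto simp: nonneg_symmetric_def S inner_diff_left inner_diff_right)
  ultimately show ?thesis by (auto intro!: exI[of _ S] blinfun_eqI)
qed

lemma
  fixes R :: "'a::{real_inner, banach} \<Rightarrow>\<^sub>L 'a"
  assumes "nonneg_symmetric R"
  shows nonneg_symmetric_op_sqrt: "nonneg_symmetric (op_sqrt R)"
    and op_sqrt_square: "op_sqrt R (op_sqrt R x) = R x"
  using someI_ex[OF nonneg_symmetric_sqrt_exists[OF assms], folded op_sqrt_def]
  by (auto simp flip: blinfun_apply_blinfun_compose)

section \<open>Preimages of minimal norm\<close>

text \<open>
  A minimising sequence is Cauchy by the parallelogram identity, since midpoints stay in the convex
  set and so cannot be shorter than the infimum.
\<close>

lemma closed_convex_min_norm_exists:
  fixes K :: "'a::{real_inner, banach} set"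
  assumes "closed K" "convex K" "K \<noteq> {}"
  shows "\<exists>x\<in>K. \<forall>y\<in>K. norm x \<le> norm y"
proof -
  define d where "d = (INF y\<in>K. norm y)"
  have bdd: "bdd_below (norm ` K)" by (intro bdd_belowI[of _ 0]) auto
  have dle: "d \<le> norm y" if "y \<in> K" for y
    unfolding d_def by (rule cINF_lower[OF bdd that])
  have d0: "0 \<le> d" unfolding d_def using assms(3) by (intro cINF_greatest) auto
  have "\<exists>y\<in>K. norm y < d + inverse (real (Suc n))" for n
    using cINF_less_iff[OF assms(3) bdd, of "d + inverse (real (Suc n))"] by (simp add: d_def)
  then obtain X where X: "\<And>n. X n \<in> K" and Xd: "\<And>n. norm (X n) < d + inverse (real (Suc n))"
    by metis
  define r where "r n = 4 * d * inverse (real (Suc n)) + 2 * (inverse (real (Suc n)))\<^sup>2" for n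
  have sq: "(norm (X n))\<^sup>2 \<le> d\<^sup>2 + 2 * d * inverse (real (Suc n)) + (inverse (real (Suc n)))\<^sup>2" for n
    using power_mono[of "norm (X n)" "d + inverse (real (Suc n))" 2] Xd[of n]
    by (simp add: power2_sum)
  have close: "(norm (X i - X j))\<^sup>2 \<le> r i + r j" for i j
  proof -
    have "(1/2) *\<^sub>R X i + (1/2) *\<^sub>R X j \<in> K"
      using X assms(2) by (intro convexD) auto
    from dle[OF this] have "d \<le> norm (X i + X j) / 2"
      by (simp flip: scaleR_right_distrib)
    then have "(2 * d)\<^sup>2 \<le> (norm (X i + X j))\<^sup>2" using d0 by (intro power_mono) auto
    moreover have "(norm (X i - X j))\<^sup>2 + (norm (X i + X j))\<^sup>2 = 2 * (norm (X i))\<^sup>2 + 2 * (norm (X j))\<^sup>2"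
      by (simp add: power2_norm_eq_inner algebra_simps)
    ultimately show ?thesis using sq[of i] sq[of j] by (simp add: r_def power_mult_distrib algebra_simps)
  qed
  have "(\<lambda>n. 4 * d * inverse (real (Suc n)) + 2 * (inverse (real (Suc n)))\<^sup>2) \<longlonglongrightarrow> 4 * d * 0 + 2 * 0\<^sup>2"
    by (intro tendsto_intros LIMSEQ_inverse_real_of_nat)
  then have r0: "r \<longlonglongrightarrow> 0" by (simp add: r_def[abs_def])
  have "Cauchy X"
  proof (rule metric_CauchyI)
    fix e :: real assume e: "0 < e"
    then have "\<forall>\<^sub>F n in sequentially. r n < e\<^sup>2 / 2"
      by (intro order_tendstoD[OF r0]) auto
    then obtain N where N: "\<And>n. n \<ge> N \<Longrightarrow> r n < e\<^sup>2 / 2" by (auto simp: eventually_sequentially)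
    have "dist (X i) (X j) < e" if "i \<ge> N" "j \<ge> N" for i j
    proof -
      have "(norm (X i - X j))\<^sup>2 < e\<^sup>2" using close[of i j] N[OF that(1)] N[OF that(2)] by linarith
      then show ?thesis using e by (simp add: dist_norm power_less_imp_less_base)
    qed
    then show "\<exists>M. \<forall>m\<ge>M. \<forall>n\<ge>M. dist (X m) (X n) < e" by blast
  qed
  then obtain x where x: "X \<longlonglongrightarrow> x" by (auto simp: Cauchy_convergent_iff convergent_def)
  have "x \<in> K" using closed_sequentially[OF assms(1) _ x] X by blast
  moreover have "norm x \<le> d + 0"
    by (rule LIMSEQ_le[OF tendsto_norm[OF x] tendsto_add[OF tendsto_const LIMSEQ_inverse_real_of_nat]])
      (use Xd in \<open>auto intro: less_imp_le\<close>)
  ultimately show ?thesis using dle by (auto intro: order_trans)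
qed

text \<open>
  The element of minimal norm in the closed affine set of preimages is orthogonal to the kernel, since
  otherwise moving along the kernel would shorten it; it is the only preimage with this property.
\<close>

lemma pseudo_inverse_eq:
  fixes S :: "'a::{real_inner, banach} \<Rightarrow>\<^sub>L 'a"
  assumes "z \<in> range S"
  shows "S (pseudo_inverse S z) = z"
proof -
  let ?P = "\<lambda>x. S x = z \<and> (\<forall>y. S y = 0 \<longrightarrow> orthogonal x y)"
  have cl: "closed {x. S x = z}"
    by (intro closed_Collect_eq) (auto intro!: continuous_intros)
  have cv: "convex {x. S x = z}"
    by (auto simp: convex_def blinfun.add_right blinfun.scaleR_right simp flip: scaleR_left_distrib)
  obtain x where x: "S x = z" and min: "\<And>y. S y = z \<Longrightarrow> norm x \<le> norm y"
    using closed_convex_min_norm_exists[OF cl cv] assms by blast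
  have "orthogonal x y" if y: "S y = 0" for y
  proof (cases "y = 0")
    case False
    define r where "r = (x \<bullet> y) / (y \<bullet> y)"
    have "S (x - r *\<^sub>R y) = z" by (simp add: blinfun.diff_right blinfun.scaleR_right x y)
    from min[OF this] have "x \<bullet> x \<le> (x - r *\<^sub>R y) \<bullet> (x - r *\<^sub>R y)" by (simp add: norm_le)
    also have "\<dots> = x \<bullet> x - (x \<bullet> y)\<^sup>2 / (y \<bullet> y)"
      using False by (simp add: r_def inner_diff_left inner_diff_right inner_commute[of y x]
          power2_eq_square field_simps)
    finally have "(x \<bullet> y)\<^sup>2 / (y \<bullet> y) \<le> 0" by simp
    then show ?thesis using False by (simp add: orthogonal_def divide_le_0_iff not_le flip: inner_gt_zero_iff)
  qed (simp add: orthogonal_def)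
  then have Px: "?P x" using x by blast
  have "x' = x" if "?P x'" for x'
  proof -
    have "S (x - x') = 0" using that x by (simp add: blinfun.diff_right)
    then have "orthogonal x (x - x')" "orthogonal x' (x - x')" using that Px by blast+
    then have "(x - x') \<bullet> (x - x') = 0" by (simp add: orthogonal_def inner_diff_left)
    then show ?thesis by simp
  qed
  then have "?P (pseudo_inverse S z)" unfolding pseudo_inverse_def using Px by (intro theI[of ?P x]) blast+
  then show ?thesis by blast
qed

section \<open>Positive functionals on trigonometric polynomials\<close>

definition character :: "'a::real_inner \<Rightarrow> 'a \<Rightarrow> complex" where
  "character x \<xi> = iexp (\<xi> \<bullet> x)"

text \<open>
  A list of pairs of coefficients and frequencies encodes a trigonometric polynomial. Evaluating it
  at \<open>character x\<close> gives the value of the polynomial at \<open>x\<close>; evaluating it at the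
  characteristic function of a measure gives the integral against that measure.
\<close>

definition trig_eval :: "(complex \<times> 'a) list \<Rightarrow> ('a \<Rightarrow> complex) \<Rightarrow> complex" where
  "trig_eval ps \<phi> = (\<Sum>(c, \<xi>)\<leftarrow>ps. c * \<phi> \<xi>)"

text \<open>
  If \<open>\<phi>\<close> is the characteristic function of a measure, this is monotonicity of the integral. Testing
  the real part of complex polynomials, and not only real-valued ones, keeps the property
  stable under products without tracking a symmetry \<open>\<phi> (- \<xi>) = cnj (\<phi> \<xi>)\<close>.
\<close>

definition trig_positive :: "('a::real_inner \<Rightarrow> complex) \<Rightarrow> bool" where
  "trig_positive \<phi> \<longleftrightarrow>
     (\<forall>ps. (\<forall>x. 0 \<le> Re (trig_eval ps (character x))) \<longrightarrow> 0 \<le> Re (trig_eval ps \<phi>))"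

lemma trig_eval_Nil [simp]: "trig_eval [] \<phi> = 0"
  and trig_eval_Cons [simp]: "trig_eval ((c, \<xi>) # ps) \<phi> = c * \<phi> \<xi> + trig_eval ps \<phi>"
  and trig_eval_append [simp]: "trig_eval (ps @ qs) \<phi> = trig_eval ps \<phi> + trig_eval qs \<phi>"
  by (simp_all add: trig_eval_def)

lemma trig_eval_map_mult:
  "trig_eval (map (\<lambda>(c, \<xi>). (c * \<psi> \<xi>, \<xi>)) ps) \<phi> = trig_eval ps (\<lambda>\<xi>. \<psi> \<xi> * \<phi> \<xi>)"
  by (induction ps) (auto simp: mult.assoc)

lemma trig_eval_add: "trig_eval ps (\<lambda>\<xi>. \<phi> \<xi> + \<psi> \<xi>) = trig_eval ps \<phi> + trig_eval ps \<psi>"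
  by (induction ps) (auto simp: algebra_simps)

lemma trig_eval_scale: "trig_eval ps (\<lambda>\<xi>. r * \<phi> \<xi>) = r * trig_eval ps \<phi>"
  by (induction ps) (auto simp: algebra_simps)

lemma trig_eval_cong:
  "(\<And>\<xi>. \<xi> \<in> snd ` set ps \<Longrightarrow> \<phi> \<xi> = \<psi> \<xi>) \<Longrightarrow> trig_eval ps \<phi> = trig_eval ps \<psi>"
  by (induction ps) auto

lemma trig_eval_tendsto:
  assumes "\<And>\<xi>. ((\<lambda>n. \<Phi> n \<xi>) \<longlongrightarrow> \<phi> \<xi>) F"
  shows "((\<lambda>n. trig_eval ps (\<Phi> n)) \<longlongrightarrow> trig_eval ps \<phi>) F"
  by (induction ps) (auto intro!: tendsto_intros assms)

lemma character_add: "character (x + y) \<xi> = character x \<xi> * character y \<xi>"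
  by (simp add: character_def inner_add_right exp_add algebra_simps)

lemma character_zero [simp]: "character 0 \<xi> = 1" "character x 0 = 1"
  by (simp_all add: character_def)

lemma norm_character [simp]: "cmod (character x \<xi>) = 1"
  by (simp add: character_def)

lemma measurable_character [measurable]:
  "(\<lambda>x. character x \<xi>) \<in> borel_measurable (borel :: 'a::{real_inner, second_countable_topology} measure)"
  unfolding character_def by measurable

lemma trig_positiveI:
  "(\<And>ps. (\<And>x. 0 \<le> Re (trig_eval ps (character x))) \<Longrightarrow> 0 \<le> Re (trig_eval ps \<phi>)) \<Longrightarrow> trig_positive \<phi>"
  by (auto simp: trig_positive_def)

lemma trig_positiveD:
  "trig_positive \<phi> \<Longrightarrow> (\<And>x. 0 \<le> Re (trig_eval ps (character x))) \<Longrightarrow> 0 \<le> Re (trig_eval ps \<phi>)"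
  by (auto simp: trig_positive_def)

lemma trig_positive_one: "trig_positive (\<lambda>\<xi>. 1)"
proof (rule trig_positiveI)
  fix ps :: "(complex \<times> 'a) list" assume "\<And>x. 0 \<le> Re (trig_eval ps (character x))"
  from this[of 0] show "0 \<le> Re (trig_eval ps (\<lambda>\<xi>. 1))"
    by (simp cong: trig_eval_cong)
qed

lemma trig_positive_add:
  "trig_positive \<phi> \<Longrightarrow> trig_positive \<psi> \<Longrightarrow> trig_positive (\<lambda>\<xi>. \<phi> \<xi> + \<psi> \<xi>)"
  by (auto simp: trig_positive_def trig_eval_add)

lemma trig_positive_scale:
  "trig_positive \<phi> \<Longrightarrow> 0 \<le> r \<Longrightarrow> trig_positive (\<lambda>\<xi>. complex_of_real r * \<phi> \<xi>)"
  by (auto simp: trig_positive_def trig_eval_scale)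

text \<open>
  The analogue of convolving measures: if the polynomial \<open>f\<close> has non-negative real part, then so
  does \<open>x \<mapsto> \<Lambda>\<^sub>\<phi> (f (x + \<cdot>))\<close>, which is again a trigonometric polynomial, and
  \<open>\<Lambda>\<^sub>\<psi>\<close> can be applied to it.
\<close>

lemma trig_positive_mult:
  assumes "trig_positive \<phi>" "trig_positive \<psi>"
  shows "trig_positive (\<lambda>\<xi>. \<phi> \<xi> * \<psi> \<xi>)"
proof (rule trig_positiveI)
  fix ps :: "(complex \<times> 'a) list"
  assume pos: "\<And>x. 0 \<le> Re (trig_eval ps (character x))"
  let ?shift = "\<lambda>\<theta>. map (\<lambda>(c, \<xi>). (c * \<theta> \<xi>, \<xi>)) ps"
  have "0 \<le> Re (trig_eval (?shift \<phi>) (character x))" for x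
  proof -
    have "0 \<le> Re (trig_eval (?shift (character x)) (character y))" for y
      using pos[of "x + y"] by (simp add: trig_eval_map_mult flip: character_add)
    from trig_positiveD[OF assms(1) this] show ?thesis
      by (simp add: trig_eval_map_mult mult.commute)
  qed
  from trig_positiveD[OF assms(2) this] show "0 \<le> Re (trig_eval ps (\<lambda>\<xi>. \<phi> \<xi> * \<psi> \<xi>))"
    by (simp add: trig_eval_map_mult)
qed

lemma trig_positive_prod:
  assumes "\<And>i. i \<in> I \<Longrightarrow> trig_positive (\<phi> i)"
  shows "trig_positive (\<lambda>\<xi>. \<Prod>i\<in>I. \<phi> i \<xi>)"
  using assms
  by (induction I rule: infinite_finite_induct) (auto intro: trig_positive_one trig_positive_mult)

lemma trig_positive_limit:
  assumes "\<And>n. trig_positive (\<Phi> n)" and "\<And>\<xi>. (\<lambda>n. \<Phi> n \<xi>) \<longlonglongrightarrow> \<phi> \<xi>"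
  shows "trig_positive \<phi>"
proof (rule trig_positiveI)
  fix ps :: "(complex \<times> 'a) list"
  assume pos: "\<And>x. 0 \<le> Re (trig_eval ps (character x))"
  have "(\<lambda>n. Re (trig_eval ps (\<Phi> n))) \<longlonglongrightarrow> Re (trig_eval ps \<phi>)"
    by (intro tendsto_Re trig_eval_tendsto assms(2))
  then show "0 \<le> Re (trig_eval ps \<phi>)"
    by (rule LIMSEQ_le_const) (use trig_positiveD[OF assms(1) pos] in blast)
qed

text \<open>
  A polynomial has finitely many frequencies, so positivity only has to be checked for functions
  that agree with \<open>\<phi>\<close> on finite sets.
\<close>

lemma trig_positive_local:
  assumes "\<And>F. finite F \<Longrightarrow> \<exists>\<psi>. trig_positive \<psi> \<and> (\<forall>\<xi>\<in>F. \<psi> \<xi> = \<phi> \<xi>)"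
  shows "trig_positive \<phi>"
proof (rule trig_positiveI)
  fix ps :: "(complex \<times> 'a) list"
  assume pos: "\<And>x. 0 \<le> Re (trig_eval ps (character x))"
  obtain \<psi> where \<psi>: "trig_positive \<psi>" "\<forall>\<xi>\<in>snd ` set ps. \<psi> \<xi> = \<phi> \<xi>"
    using assms[of "snd ` set ps"] by auto
  then have "trig_eval ps \<phi> = trig_eval ps \<psi>" by (intro trig_eval_cong) auto
  then show "0 \<le> Re (trig_eval ps \<phi>)" using trig_positiveD[OF \<psi>(1) pos] by simp
qed

lemma trig_positive_exp:
  assumes "trig_positive \<phi>"
  shows "trig_positive (\<lambda>\<xi>. exp (\<phi> \<xi>))"
proof (rule trig_positive_limit)
  have power: "trig_positive (\<lambda>\<xi>. \<phi> \<xi> ^ k)" for k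
    by (induction k) (auto intro: trig_positive_one trig_positive_mult assms)
  have "trig_positive (\<lambda>\<xi>. \<phi> \<xi> ^ k /\<^sub>R fact k)" for k
    using trig_positive_scale[OF power, of "inverse (fact k)" k] by (simp add: scaleR_conv_of_real)
  then show "trig_positive (\<lambda>\<xi>. \<Sum>k<n. \<phi> \<xi> ^ k /\<^sub>R fact k)" for n
    by (induction n) (use trig_positive_scale[OF trig_positive_one, of 0] in
        \<open>auto intro: trig_positive_add\<close>)
  show "(\<lambda>n. \<Sum>k<n. \<phi> \<xi> ^ k /\<^sub>R fact k) \<longlonglongrightarrow> exp (\<phi> \<xi>)" for \<xi>
    using exp_converges[of "\<phi> \<xi>"] by (simp add: sums_def)
qed

lemma (in finite_measure) integrable_character:
  assumes "g \<in> borel_measurable M"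
  shows "integrable M (\<lambda>u. character (g u) (\<xi> :: 'b :: {real_inner, second_countable_topology}))"
  by (rule integrable_const_bound[of _ 1]) (use assms in auto)

lemma (in finite_measure)
  assumes "g \<in> borel_measurable M"
  shows integrable_trig_eval: "integrable M (\<lambda>u. trig_eval ps (character (g u)))"
    and integral_trig_eval: "(\<integral>u. trig_eval ps (character (g u)) \<partial>M)
      = trig_eval ps (\<lambda>\<xi> :: 'b :: {real_inner, second_countable_topology}. \<integral>u. character (g u) \<xi> \<partial>M)"
proof -
  have "integrable M (\<lambda>u. trig_eval ps (character (g u))) \<and>
    (\<integral>u. trig_eval ps (character (g u)) \<partial>M) = trig_eval ps (\<lambda>\<xi>. \<integral>u. character (g u) \<xi> \<partial>M)"
    by (induction ps) (auto simp: integrable_character[OF assms])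
  then show "integrable M (\<lambda>u. trig_eval ps (character (g u)))"
    "(\<integral>u. trig_eval ps (character (g u)) \<partial>M) = trig_eval ps (\<lambda>\<xi>. \<integral>u. character (g u) \<xi> \<partial>M)"
    by auto
qed

text \<open>
  Integration preserves the inequality that defines positivity. The map \<open>g\<close> covers both measures on the
  space itself and laws carried by a line.
\<close>

lemma (in finite_measure) trig_positive_integral:
  assumes "g \<in> borel_measurable M"
  shows "trig_positive (\<lambda>\<xi> :: 'b :: {real_inner, second_countable_topology}. \<integral>u. character (g u) \<xi> \<partial>M)"
proof (rule trig_positiveI)
  fix ps :: "(complex \<times> 'b) list"
  assume pos: "\<And>x. 0 \<le> Re (trig_eval ps (character x))"
  then have "0 \<le> (\<integral>u. Re (trig_eval ps (character (g u))) \<partial>M)"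
    by simp
  also have "\<dots> = Re (trig_eval ps (\<lambda>\<xi>. \<integral>u. character (g u) \<xi> \<partial>M))"
    by (simp add: integral_trig_eval[OF assms, symmetric] integrable_trig_eval[OF assms])
  finally show "0 \<le> Re (trig_eval ps (\<lambda>\<xi>. \<integral>u. character (g u) \<xi> \<partial>M))" .
qed

lemma trig_positive_character: "trig_positive (character x)"
  by (auto simp: trig_positive_def)

section \<open>Gaussian characteristic functions\<close>

lemma integral_character_std_normal:
  "(\<integral>u. character (u *\<^sub>R v) \<xi> \<partial>std_normal_distribution) = complex_of_real (exp (- (\<xi> \<bullet> v)\<^sup>2 / 2))"
  using fun_cong[OF char_std_normal_distribution, of "\<xi> \<bullet> v"]
  by (simp add: char_def character_def mult.commute)

lemma trig_positive_gaussian_rank_one: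
  fixes v :: "'a::{real_inner, second_countable_topology}"
  shows "trig_positive (\<lambda>\<xi>. complex_of_real (exp (- (\<xi> \<bullet> v)\<^sup>2 / 2)))"
proof -
  interpret real_distribution std_normal_distribution by (rule real_dist_normal_dist)
  show ?thesis
    using trig_positive_integral[of "\<lambda>u. u *\<^sub>R v"] by (simp add: integral_character_std_normal)
qed

text \<open>
  Zero vectors may occur in \<open>C\<close>; their terms vanish because \<open>0 / 0 = 0\<close>.
\<close>

lemma norm_squared_orthogonal_expansion:
  fixes C :: "'a::real_inner set"
  assumes "finite C" "pairwise orthogonal C" "w \<in> span C"
  shows "(norm w)\<^sup>2 = (\<Sum>c\<in>C. (w \<bullet> c)\<^sup>2 / (c \<bullet> c))"
proof -
  obtain r where w: "w = (\<Sum>c\<in>C. r c *\<^sub>R c)"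
    using assms(3) span_finite[OF assms(1)] by auto
  have wc: "w \<bullet> c = r c * (c \<bullet> c)" if "c \<in> C" for c
  proof -
    have "w \<bullet> c = (\<Sum>d\<in>C. r d * (d \<bullet> c))" by (simp add: w inner_sum_left)
    also have "\<dots> = (\<Sum>d\<in>C. if d = c then r c * (c \<bullet> c) else 0)"
      using assms(2) that by (intro sum.cong) (auto simp: pairwise_def orthogonal_def)
    finally show ?thesis using that assms(1) by simp
  qed
  have "(norm w)\<^sup>2 = (\<Sum>c\<in>C. r c * (w \<bullet> c))"
    unfolding power2_norm_eq_inner by (subst (2) w) (simp add: inner_sum_right)
  also have "\<dots> = (\<Sum>c\<in>C. (w \<bullet> c)\<^sup>2 / (c \<bullet> c))"
    by (intro sum.cong) (auto simp: wc power2_eq_square)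
  finally show ?thesis .
qed

text \<open>
  For finitely many frequencies the vectors \<open>T \<xi>\<close> span a finite-dimensional space. Expanding in an
  orthogonal basis of it, obtained by Gram--Schmidt, factors the Gaussian into one-dimensional
  Gaussians with directions determined by the adjoint \<open>T'\<close>. This replaces the construction of a
  Gaussian measure with covariance \<open>T' T\<close>.
\<close>

lemma trig_positive_gaussian:
  fixes T T' :: "'a::{real_inner, second_countable_topology} \<Rightarrow> 'a"
  assumes adj: "\<And>\<xi> c. T \<xi> \<bullet> c = \<xi> \<bullet> T' c"
  shows "trig_positive (\<lambda>\<xi>. complex_of_real (exp (- (norm (T \<xi>))\<^sup>2 / 2)))"
proof (rule trig_positive_local)
  fix F :: "'a set" assume "finite F"
  then obtain C where C: "finite C" "span C = span (T ` F)" "pairwise orthogonal C"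
    using basis_orthogonal[of "T ` F"] by auto
  define v where "v c = T' c /\<^sub>R norm c" for c
  let ?\<psi> = "\<lambda>\<xi>. \<Prod>c\<in>C. complex_of_real (exp (- (\<xi> \<bullet> v c)\<^sup>2 / 2))"
  have "trig_positive ?\<psi>"
    by (intro trig_positive_prod trig_positive_gaussian_rank_one)
  moreover have "?\<psi> \<xi> = complex_of_real (exp (- (norm (T \<xi>))\<^sup>2 / 2))" if "\<xi> \<in> F" for \<xi>
  proof -
    have "(norm (T \<xi>))\<^sup>2 = (\<Sum>c\<in>C. (T \<xi> \<bullet> c)\<^sup>2 / (c \<bullet> c))"
      using C that by (intro norm_squared_orthogonal_expansion) (auto intro: span_base)
    also have "\<dots> = (\<Sum>c\<in>C. (\<xi> \<bullet> v c)\<^sup>2)"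
      by (intro sum.cong) (auto simp: v_def adj power_mult_distrib dot_square_norm field_simps)
    finally have "exp (- (norm (T \<xi>))\<^sup>2 / 2) = (\<Prod>c\<in>C. exp (- (\<xi> \<bullet> v c)\<^sup>2 / 2))"
      using C(1) by (simp add: sum_negf sum_divide_distrib flip: exp_sum)
    then show ?thesis by simp
  qed
  ultimately show "\<exists>\<psi>. trig_positive \<psi> \<and>
      (\<forall>\<xi>\<in>F. \<psi> \<xi> = complex_of_real (exp (- (norm (T \<xi>))\<^sup>2 / 2)))" by blast
qed

section \<open>The jump part of the exponent\<close>

definition levy_integrand :: "'a::real_inner \<Rightarrow> 'a \<Rightarrow> complex" where
  "levy_integrand \<xi> x = iexp (\<xi> \<bullet> x) - 1
     - \<i> * complex_of_real (\<xi> \<bullet> x) / complex_of_real (1 + (norm x)\<^sup>2)"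

lemma measurable_levy_integrand [measurable]:
  "levy_integrand \<xi> \<in> borel_measurable (borel :: 'a::{real_inner, second_countable_topology} measure)"
  unfolding levy_integrand_def[abs_def] by measurable

lemma le_one_plus_square: "(t :: real) \<le> 1 + t\<^sup>2"
  using sum_squares_bound[of t 1] zero_le_power2[of t]
  unfolding power_one mult_1_right by linarith

text \<open>
  Near 0 the integrand is \<open>e\<^sup>i\<^sup>u - 1 - i u\<close>, of second order in \<open>u = \<langle>\<xi>, x\<rangle>\<close>, plus a correction of order
  \<open>\<bar>u\<bar> \<bar>x\<bar>\<^sup>2\<close>; away from 0 every term is bounded. The bound is the function that Levy measures
  integrate by definition.
\<close>

lemma levy_integrand_bound:
  "cmod (levy_integrand \<xi> x) \<le> (2 + norm \<xi> + (norm \<xi>)\<^sup>2) * min 1 ((norm x)\<^sup>2)"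
proof -
  let ?n = "norm x" and ?k = "norm \<xi>"
  define u where "u = \<xi> \<bullet> x"
  have u: "\<bar>u\<bar> \<le> ?k * ?n" unfolding u_def by (rule Cauchy_Schwarz_ineq2)
  have pos: "1 + ?n\<^sup>2 > 0" by (simp add: add_pos_nonneg)
  show ?thesis
  proof (cases "?n \<le> 1")
    case True
    have 1: "cmod (iexp u - 1 - \<i> * u) \<le> \<bar>u\<bar>\<^sup>2 / 2"
      using iexp_approx1[of u 1] by (simp add: algebra_simps power2_eq_square)
    have 2: "cmod (\<i> * u - \<i> * u / complex_of_real (1 + ?n\<^sup>2)) \<le> ?k * ?n\<^sup>2"
    proof -
      have "\<i> * u - \<i> * u / complex_of_real (1 + ?n\<^sup>2) = \<i> * complex_of_real (u * (?n\<^sup>2 / (1 + ?n\<^sup>2)))"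
      proof -
        have "u - u / (1 + ?n\<^sup>2) = u * (?n\<^sup>2 / (1 + ?n\<^sup>2))"
          using pos by (simp add: field_simps)
        then show ?thesis by (metis of_real_diff of_real_divide right_diff_distrib times_divide_eq_right)
      qed
      then have "cmod (\<i> * u - \<i> * u / complex_of_real (1 + ?n\<^sup>2)) = \<bar>u\<bar> * (?n\<^sup>2 / (1 + ?n\<^sup>2))"
        by (simp add: norm_mult abs_mult del: of_real_mult of_real_divide)
      also have "\<dots> \<le> ?k * ?n\<^sup>2"
      proof (rule mult_mono)
        show "\<bar>u\<bar> \<le> ?k" using u True mult_left_le[of ?n ?k] by simp
        show "?n\<^sup>2 / (1 + ?n\<^sup>2) \<le> ?n\<^sup>2" using pos by (simp add: divide_le_eq mult_left_le algebra_simps)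
      qed auto
      finally show ?thesis .
    qed
    have "\<bar>u\<bar>\<^sup>2 \<le> (?k * ?n)\<^sup>2" using u by (intro power_mono) auto
    moreover have "\<bar>u\<bar>\<^sup>2 / 2 \<le> \<bar>u\<bar>\<^sup>2" by simp
    ultimately have 3: "\<bar>u\<bar>\<^sup>2 / 2 \<le> ?k\<^sup>2 * ?n\<^sup>2" unfolding power_mult_distrib by linarith
    have "levy_integrand \<xi> x = (iexp u - 1 - \<i> * u) + (\<i> * u - \<i> * u / complex_of_real (1 + ?n\<^sup>2))"
      by (simp add: levy_integrand_def u_def)
    then have "cmod (levy_integrand \<xi> x) \<le> ?k\<^sup>2 * ?n\<^sup>2 + ?k * ?n\<^sup>2"
      using norm_triangle_mono[OF order_trans[OF 1 3] 2] by simp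
    also have "\<dots> \<le> (2 + ?k + ?k\<^sup>2) * ?n\<^sup>2" by (simp add: algebra_simps)
    also have "?n\<^sup>2 = min 1 (?n\<^sup>2)" using power_le_one[OF norm_ge_zero True, of 2] by simp
    finally show ?thesis .
  next
    case False
    have "cmod (iexp u - 1) \<le> 2" using norm_triangle_ineq4[of "iexp u" 1] by simp
    moreover have "cmod (\<i> * u / complex_of_real (1 + ?n\<^sup>2)) \<le> ?k"
    proof -
      have "cmod (\<i> * u / complex_of_real (1 + ?n\<^sup>2)) = \<bar>u\<bar> / (1 + ?n\<^sup>2)"
        unfolding norm_divide norm_mult norm_of_real using pos by simp
      also have "\<dots> \<le> ?k"
      proof -
        have "?n \<le> 1 + ?n\<^sup>2" by (rule le_one_plus_square)
        then have "?k * ?n \<le> ?k * (1 + ?n\<^sup>2)" by (rule mult_left_mono) simp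
        then show ?thesis using u pos by (simp add: divide_le_eq)
      qed
      finally show ?thesis .
    qed
    ultimately have "cmod (levy_integrand \<xi> x) \<le> 2 + ?k"
      unfolding levy_integrand_def u_def
      using norm_triangle_ineq4[of "iexp (\<xi> \<bullet> x) - 1"] by (meson add_mono order_trans)
    also have "\<dots> \<le> 2 + ?k + ?k\<^sup>2" by simp
    finally show ?thesis using False by (simp add: min_def power_le_one_iff)
  qed
qed

lemma integrable_levy_bound:
  fixes m :: "'a::{real_inner, second_countable_topology} measure"
  assumes "levy_measure m"
  shows "integrable m (\<lambda>x. min 1 ((norm x)\<^sup>2))"
  using assms by (intro integrableI_bounded) (auto simp: levy_measure_def cong: measurable_cong_sets)

text \<open>
  Restricting \<open>m\<close> to \<open>\<bar>x\<bar> > 1 / (n + 1)\<close> gives a finite measure, for which the expression is the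
  characteristic function of a translated compound Poisson law: a positive constant times a
  character times the exponential of the characteristic function of the restricted measure. Dominated
  convergence removes the restriction.
\<close>

lemma trig_positive_levy:
  fixes m :: "'a::{real_inner, banach, second_countable_topology} measure"
  assumes m: "levy_measure m"
  shows "trig_positive (\<lambda>\<xi>. exp (\<integral>x. levy_integrand \<xi> x \<partial>m))"
proof (rule trig_positive_limit)
  have [measurable_cong]: "sets m = sets borel" using m by (simp add: levy_measure_def)
  define B where "B n = {x :: 'a. inverse (real (Suc n)) < norm x}" for n
  have B[measurable]: "B n \<in> sets borel" for n
    unfolding B_def by measurable
  have intb: "integrable m (\<lambda>x. (2 + norm \<xi> + (norm \<xi>)\<^sup>2) * min 1 ((norm x)\<^sup>2))" for \<xi> :: 'a
    by (intro integrable_mult_right integrable_levy_bound m)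
  show "(\<lambda>n. exp (\<integral>x. indicator (B n) x *\<^sub>R levy_integrand \<xi> x \<partial>m))
      \<longlonglongrightarrow> exp (\<integral>x. levy_integrand \<xi> x \<partial>m)" for \<xi>
  proof (intro tendsto_exp integral_dominated_convergence[OF _ _ intb[of \<xi>]] AE_I2)
    fix x :: 'a
    show "(\<lambda>n. indicator (B n) x *\<^sub>R levy_integrand \<xi> x) \<longlonglongrightarrow> levy_integrand \<xi> x"
    proof (cases "x = 0")
      case True
      then show ?thesis by (simp add: levy_integrand_def)
    next
      case False
      then have "\<forall>\<^sub>F n in sequentially. inverse (real (Suc n)) < norm x"
        by (intro order_tendstoD[OF LIMSEQ_inverse_real_of_nat]) auto
      then show ?thesis
        by (intro tendsto_eventually) (auto simp: B_def elim: eventually_mono)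
    qed
    show "norm (indicator (B n) x *\<^sub>R levy_integrand \<xi> x) \<le> (2 + norm \<xi> + (norm \<xi>)\<^sup>2) * min 1 ((norm x)\<^sup>2)" for n
      using levy_integrand_bound[of \<xi> x] order_trans[OF norm_ge_zero levy_integrand_bound[of \<xi> x]]
      by (auto simp: indicator_def)
  qed measurable
  show "trig_positive (\<lambda>\<xi>. exp (\<integral>x. indicator (B n) x *\<^sub>R levy_integrand \<xi> x \<partial>m))" for n
  proof -
    let ?M = "restrict_space m (B n)"
    have fin: "emeasure m (B n) < \<infinity>"
    proof -
      define \<delta> where "\<delta> = (inverse (real (Suc n)))\<^sup>2"
      have \<delta>: "0 < \<delta>" "\<delta> \<le> 1" by (auto simp: \<delta>_def power_le_one inverse_le_1_iff)
      have "integrable m (\<lambda>x. inverse \<delta> * min 1 ((norm x)\<^sup>2))"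
        by (intro integrable_mult_right integrable_levy_bound m)
      then have "integrable m (indicator (B n) :: 'a \<Rightarrow> real)"
      proof (rule Bochner_Integration.integrable_bound)
        show "AE x in m. norm (indicator (B n) x :: real) \<le> norm (inverse \<delta> * min 1 ((norm x)\<^sup>2))"
        proof (rule AE_I2)
          fix x
          have "\<delta> \<le> min 1 ((norm x)\<^sup>2)" if "x \<in> B n"
            using that \<delta> power_mono[of "inverse (real (Suc n))" "norm x" 2] by (auto simp: B_def \<delta>_def)
          then show "norm (indicator (B n) x :: real) \<le> norm (inverse \<delta> * min 1 ((norm x)\<^sup>2))"
            using \<delta> by (auto simp: indicator_def field_simps abs_mult)
        qed
      qed measurable
      then show ?thesis by (simp add: integrable_indicator_iff)
    qed
    interpret M: finite_measure ?M
      by (rule finite_measureI) (use fin in \<open>simp add: emeasure_restrict_space space_restrict_space\<close>)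
    \<comment> \<open>the compensator, which contributes the translation by \<open>- b\<close>\<close>
    define w where "w x = (1 / (1 + (norm x)\<^sup>2)) *\<^sub>R x" for x :: 'a
    have wm[measurable]: "w \<in> borel_measurable borel" unfolding w_def by measurable
    have wb: "norm (w x) \<le> 1" for x
    proof -
      have "norm x \<le> 1 + (norm x)\<^sup>2" by (rule le_one_plus_square)
      then show ?thesis by (simp add: w_def divide_le_eq add_pos_nonneg)
    qed
    have w: "integrable ?M w"
      by (rule M.integrable_const_bound[of _ 1]) (auto simp: wb measurable_restrict_space1)
    define b where "b = (\<integral>x. w x \<partial>?M)"
    have id: "(\<lambda>x. x) \<in> borel_measurable ?M" by (simp add: measurable_restrict_space1)
    have eq: "(\<integral>x. indicator (B n) x *\<^sub>R levy_integrand \<xi> x \<partial>m)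
        = (\<integral>x. character x \<xi> \<partial>?M) + complex_of_real (- measure ?M (space ?M)) + \<i> * complex_of_real (\<xi> \<bullet> (- b))" for \<xi>
    proof -
      have "(\<integral>x. indicator (B n) x *\<^sub>R levy_integrand \<xi> x \<partial>m) = (\<integral>x. levy_integrand \<xi> x \<partial>?M)"
        by (simp add: integral_restrict_space)
      also have "\<dots> = (\<integral>x. character x \<xi> - 1 - \<i> * complex_of_real (\<xi> \<bullet> w x) \<partial>?M)"
        by (simp add: levy_integrand_def character_def w_def)
      also have "\<dots> = (\<integral>x. character x \<xi> \<partial>?M) - (\<integral>x. 1 \<partial>?M) - \<i> * (\<integral>x. complex_of_real (\<xi> \<bullet> w x) \<partial>?M)"
        using M.integrable_character[OF id] w by simp
      also have "(\<integral>x. complex_of_real (\<xi> \<bullet> w x) \<partial>?M) = complex_of_real (\<xi> \<bullet> b)"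
        using w by (simp add: b_def)
      finally show ?thesis by (simp add: scaleR_conv_of_real)
    qed
    have "trig_positive (\<lambda>\<xi>. complex_of_real (exp (- measure ?M (space ?M))) *
        (exp (\<integral>x. character x \<xi> \<partial>?M) * character (- b) \<xi>))"
      by (intro trig_positive_scale trig_positive_mult trig_positive_exp M.trig_positive_integral id
          trig_positive_character) simp
    moreover have "exp (\<integral>x. indicator (B n) x *\<^sub>R levy_integrand \<xi> x \<partial>m)
        = complex_of_real (exp (- measure ?M (space ?M))) *
        (exp (\<integral>x. character x \<xi> \<partial>?M) * character (- b) \<xi>)" for \<xi>
      unfolding eq character_def[of "- b"] exp_add exp_of_real by (simp only: mult_ac)
    ultimately show ?thesis by simp
  qed
qed

section \<open>The algebra of real trigonometric polynomials\<close>

definition trig_poly :: "('a::real_inner \<Rightarrow> real) \<Rightarrow> bool" where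
  "trig_poly g \<longleftrightarrow> (\<exists>ps. \<forall>x. g x = Re (trig_eval ps (character x)))"

lemma trig_poly_const [intro]: "trig_poly (\<lambda>x. r)"
  unfolding trig_poly_def by (rule exI[of _ "[(complex_of_real r, 0)]"]) simp

lemma trig_poly_add [intro]:
  assumes "trig_poly f" "trig_poly g" shows "trig_poly (\<lambda>x. f x + g x)"
proof -
  obtain ps qs where "\<forall>x. f x = Re (trig_eval ps (character x))" "\<forall>x. g x = Re (trig_eval qs (character x))"
    using assms by (auto simp: trig_poly_def)
  then show ?thesis unfolding trig_poly_def by (intro exI[of _ "ps @ qs"]) simp
qed

lemma trig_eval_product:
  "\<exists>rs. \<forall>x. trig_eval rs (character x) = trig_eval ps (character x) * trig_eval qs (character x)"
proof (induction ps)
  case Nil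
  show ?case by (rule exI[of _ "[]"]) simp
next
  case (Cons p ps)
  obtain c \<xi> where p: "p = (c, \<xi>)" by (cases p)
  obtain rs where rs: "\<forall>x. trig_eval rs (character x) = trig_eval ps (character x) * trig_eval qs (character x)"
    using Cons by auto
  have "trig_eval (map (\<lambda>(d, \<eta>). (c * d, \<xi> + \<eta>)) qs) (character x)
      = c * character x \<xi> * trig_eval qs (character x)" for x
    by (induction qs) (auto simp: character_def inner_add_left exp_add algebra_simps)
  then show ?case
    using rs by (intro exI[of _ "map (\<lambda>(d, \<eta>). (c * d, \<xi> + \<eta>)) qs @ rs"]) (simp add: p algebra_simps)
qed

lemma trig_eval_cnj: "trig_eval (map (\<lambda>(c, \<xi>). (cnj c, - \<xi>)) ps) (character x) = cnj (trig_eval ps (character x))"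
  by (induction ps) (auto simp: character_def exp_cnj)

text \<open>
  Passing to real parts does not commute with products, so one factor is first replaced by the
  polynomial \<open>f + cnj f\<close>, which takes the real values \<open>2 Re f\<close>.
\<close>

lemma trig_poly_mult [intro]:
  assumes "trig_poly f" "trig_poly g" shows "trig_poly (\<lambda>x. f x * g x)"
proof -
  obtain ps qs where pq: "\<forall>x. f x = Re (trig_eval ps (character x))" "\<forall>x. g x = Re (trig_eval qs (character x))"
    using assms by (auto simp: trig_poly_def)
  let ?ps = "ps @ map (\<lambda>(c, \<xi>). (cnj c, - \<xi>)) ps"
  obtain rs where rs: "\<forall>x. trig_eval rs (character x) = trig_eval ?ps (character x) * trig_eval qs (character x)"
    using trig_eval_product by blast
  have "trig_eval ?ps (character x) = complex_of_real (2 * f x)" for x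
    by (simp add: trig_eval_cnj complex_add_cnj pq del: trig_eval_append)
      (simp add: trig_eval_cnj complex_add_cnj)
  then have "Re (trig_eval rs (character x)) = 2 * (f x * g x)" for x
    using rs pq by simp
  then have "trig_poly (\<lambda>x. 2 * (f x * g x))" unfolding trig_poly_def by metis
  then obtain us where us: "\<forall>x. 2 * (f x * g x) = Re (trig_eval us (character x))"
    by (auto simp: trig_poly_def)
  have half: "trig_eval (map (\<lambda>(c, \<xi>). (c / 2, \<xi>)) us) \<phi> = trig_eval us \<phi> / 2" for \<phi>
    by (induction us) (auto simp: field_simps)
  have "f x * g x = Re (trig_eval (map (\<lambda>(c, \<xi>). (c / 2, \<xi>)) us) (character x))" for x
    using us[rule_format, of x] by (simp add: half)
  then show ?thesis unfolding trig_poly_def by blast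
qed

lemma trig_poly_polynomial:
  assumes "real_polynomial_function q" "trig_poly g"
  shows "trig_poly (\<lambda>x. q (g x))"
  using assms(1)
proof induction
  case (linear f)
  then obtain c where "f = (\<lambda>x. x * c)" by (auto simp: real_bounded_linear)
  then show ?case using assms(2) by (auto intro: trig_poly_mult)
qed auto

lemma trig_poly_bounded:
  assumes "trig_poly g"
  obtains B where "\<And>x. \<bar>g x\<bar> \<le> B"
proof -
  obtain ps where ps: "\<forall>x. g x = Re (trig_eval ps (character x))" using assms by (auto simp: trig_poly_def)
  have "\<exists>B. \<forall>x. cmod (trig_eval ps (character x)) \<le> B"
  proof (induction ps)
    case (Cons p ps)
    obtain c \<xi> where p: "p = (c, \<xi>)" by (cases p)
    obtain B where "\<forall>x. cmod (trig_eval ps (character x)) \<le> B" using Cons by auto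
    then have "cmod (trig_eval (p # ps) (character x)) \<le> cmod c + B" for x
      using norm_triangle_mono[of "c * character x \<xi>" "cmod c" "trig_eval ps (character x)" B]
      by (simp add: p norm_mult)
    then show ?case by blast
  qed (auto intro: exI[of _ 0])
  then show ?thesis using that ps abs_Re_le_cmod order_trans by metis
qed

lemma trig_eval_measurable [measurable]:
  "(\<lambda>x. trig_eval ps (character x)) \<in> borel_measurable (borel :: 'a::{real_inner, second_countable_topology} measure)"
proof (induction ps)
  case (Cons p ps)
  then show ?case by (cases p) simp
qed simp

lemma trig_poly_measurable:
  assumes "trig_poly (g :: 'a::{real_inner, second_countable_topology} \<Rightarrow> real)"
  shows "g \<in> borel_measurable borel"
proof -
  obtain ps where "g = (\<lambda>x. Re (trig_eval ps (character x)))" using assms by (auto simp: trig_poly_def)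
  then show ?thesis by simp
qed

text \<open>
  A trigonometric polynomial is bounded, so the Weierstrass theorem on an interval containing its range
  approximates \<open>\<phi>\<close> by an ordinary polynomial, and polynomials preserve the algebra.
\<close>

lemma trig_poly_uniform_approximation:
  assumes g: "trig_poly g" and \<phi>: "continuous_on UNIV (\<phi> :: real \<Rightarrow> real)" and e: "0 < e"
  obtains q where "trig_poly q" "\<And>x. \<bar>\<phi> (g x) - q x\<bar> < e"
proof -
  obtain B where B: "\<And>x. \<bar>g x\<bar> \<le> B" using trig_poly_bounded[OF g] by blast
  obtain q where q: "real_polynomial_function q" "\<And>y. y \<in> {-B..B} \<Longrightarrow> \<bar>\<phi> y - q y\<bar> < e"
    using Stone_Weierstrass_real_polynomial_function[of "{-B..B}" \<phi> e] e continuous_on_subset[OF \<phi>]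
    by auto
  show ?thesis
  proof (rule that)
    show "trig_poly (\<lambda>x. q (g x))" by (rule trig_poly_polynomial[OF q(1) g])
    show "\<bar>\<phi> (g x) - q (g x)\<bar> < e" for x using B[of x] by (intro q(2)) auto
  qed
qed

section \<open>Translation of a one-dimensional Gaussian\<close>

lemma std_normal_density_shift:
  "std_normal_density u * exp (c * u - c\<^sup>2 / 2) = std_normal_density (u - c)"
proof -
  have "- u\<^sup>2 / 2 + (c * u - c\<^sup>2 / 2) = - (u - c)\<^sup>2 / 2" by (simp add: power2_eq_square field_simps)
  then show ?thesis by (simp add: std_normal_density_def mult.assoc flip: exp_add)
qed

lemma
  fixes f :: "real \<Rightarrow> 'b::{banach, second_countable_topology}"
  assumes [measurable]: "f \<in> borel_measurable borel"
  shows std_normal_shift: "(\<integral>u. exp (c * u - c\<^sup>2 / 2) *\<^sub>R f u \<partial>std_normal_distribution)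
      = (\<integral>u. f (c + u) \<partial>std_normal_distribution)"
    and std_normal_shift_integrable: "integrable std_normal_distribution (\<lambda>u. exp (c * u - c\<^sup>2 / 2) *\<^sub>R f u)
      \<longleftrightarrow> integrable std_normal_distribution (\<lambda>u. f (c + u))"
proof -
  let ?g = "\<lambda>u. std_normal_density (u - c) *\<^sub>R f u"
  have "(\<integral>u. exp (c * u - c\<^sup>2 / 2) *\<^sub>R f u \<partial>std_normal_distribution) = (\<integral>u. ?g u \<partial>lborel)"
    by (subst integral_density) (simp_all add: std_normal_density_shift)
  also have "\<dots> = (\<integral>u. ?g (c + 1 * u) \<partial>lborel)"
    by (subst lborel_integral_real_affine[of 1 _ c]) simp_all
  also have "\<dots> = (\<integral>u. f (c + u) \<partial>std_normal_distribution)"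
    by (subst integral_density) simp_all
  finally show "(\<integral>u. exp (c * u - c\<^sup>2 / 2) *\<^sub>R f u \<partial>std_normal_distribution)
      = (\<integral>u. f (c + u) \<partial>std_normal_distribution)" .
  have "integrable std_normal_distribution (\<lambda>u. exp (c * u - c\<^sup>2 / 2) *\<^sub>R f u) \<longleftrightarrow> integrable lborel ?g"
    by (subst integrable_density) (simp_all add: std_normal_density_shift)
  also have "\<dots> \<longleftrightarrow> integrable lborel (\<lambda>u. ?g (c + 1 * u))"
    by (subst lborel_integrable_real_affine_iff[of 1 _ c]) simp_all
  also have "\<dots> \<longleftrightarrow> integrable std_normal_distribution (\<lambda>u. f (c + u))"
    by (subst integrable_density) simp_all
  finally show "integrable std_normal_distribution (\<lambda>u. exp (c * u - c\<^sup>2 / 2) *\<^sub>R f u)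
      \<longleftrightarrow> integrable std_normal_distribution (\<lambda>u. f (c + u))" .
qed

lemma
  fixes b c :: real
  shows std_normal_moment_integrable: "integrable std_normal_distribution (\<lambda>u. exp (b * (c * u - c\<^sup>2 / 2)))"
    and std_normal_moment: "(\<integral>u. exp (b * (c * u - c\<^sup>2 / 2)) \<partial>std_normal_distribution)
      = exp ((b\<^sup>2 - b) * c\<^sup>2 / 2)"
proof -
  interpret real_distribution std_normal_distribution by (rule real_dist_normal_dist)
  have eq: "exp (b * (c * u - c\<^sup>2 / 2)) = exp ((b\<^sup>2 - b) * c\<^sup>2 / 2) * (exp ((b * c) * u - (b * c)\<^sup>2 / 2) *\<^sub>R 1)" for u
    by (simp add: power_mult_distrib field_simps flip: exp_add)
  show "integrable std_normal_distribution (\<lambda>u. exp (b * (c * u - c\<^sup>2 / 2)))"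
    unfolding eq by (intro integrable_mult_right, subst std_normal_shift_integrable) simp_all
  show "(\<integral>u. exp (b * (c * u - c\<^sup>2 / 2)) \<partial>std_normal_distribution) = exp ((b\<^sup>2 - b) * c\<^sup>2 / 2)"
    unfolding eq integral_mult_right_zero by (subst std_normal_shift) (simp_all add: prob_space[simplified])
qed

text \<open>
  The measure has a one-dimensional standard Gaussian component along \<open>v\<close>, expressed through
  characteristic functions: \<open>\<phi>\<close> stands for the characteristic function of the remaining component.
\<close>

definition gaussian_split :: "'a::real_inner measure \<Rightarrow> 'a \<Rightarrow> bool" where
  "gaussian_split \<mu> v \<longleftrightarrow>
     (\<exists>\<phi>. trig_positive \<phi> \<and>
       (\<forall>\<xi>. (\<integral>x. character x \<xi> \<partial>\<mu>) = \<phi> \<xi> * complex_of_real (exp (- (\<xi> \<bullet> v)\<^sup>2 / 2))))"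

text \<open>
  If \<open>\<mu>\<close> is the law of \<open>X + g v\<close>, then the left-hand side is the expectation of \<open>f (X + g v) \<rho>(g)\<close> with
  \<open>\<rho>(u) = exp (c u - c\<^sup>2 / 2)\<close>, and the claim follows by integrating the pointwise hypothesis. With
  only a positive functional in place of \<open>X\<close>, the same is done in two steps: integrating the
  hypothesis over \<open>u\<close> alone shows that a certain trigonometric polynomial in \<open>x\<close> is non-negative, and
  the functional is then applied to that polynomial. The hypothesis is linear in \<open>f\<close> and \<open>p\<close> so that
  both sides remain trigonometric polynomials.
\<close>

lemma shift_inequality_trig:
  fixes \<mu> :: "'a::{real_inner, second_countable_topology} measure"
  assumes \<mu>: "borel_prob \<mu>" "gaussian_split \<mu> v"
    and "trig_poly f" "trig_poly p"
    and le: "\<And>x u. f x * exp (c * u - c\<^sup>2 / 2) \<le> p x + K * exp (b * (c * u - c\<^sup>2 / 2))"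
  shows "(\<integral>x. f (x + c *\<^sub>R v) \<partial>\<mu>) \<le> (\<integral>x. p x \<partial>\<mu>) + K * exp ((b\<^sup>2 - b) * c\<^sup>2 / 2)"
proof -
  have [measurable_cong]: "sets \<mu> = sets borel" using \<mu> by (simp add: borel_prob_def)
  interpret prob_space \<mu> using \<mu> by (simp add: borel_prob_def)
  interpret N: real_distribution std_normal_distribution by (rule real_dist_normal_dist)
  obtain P where P: "\<And>x. f x = Re (trig_eval P (character x))" using assms(3) by (auto simp: trig_poly_def)
  obtain Q where Q: "\<And>x. p x = Re (trig_eval Q (character x))" using assms(4) by (auto simp: trig_poly_def)
  obtain \<phi> where \<phi>: "trig_positive \<phi>" and \<mu>\<phi>: "\<And>\<xi>. (\<integral>x. character x \<xi> \<partial>\<mu>) = \<phi> \<xi> * complex_of_real (exp (- (\<xi> \<bullet> v)\<^sup>2 / 2))"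
    using \<mu>(2) by (auto simp: gaussian_split_def)
  define \<gamma> where "\<gamma> \<xi> = complex_of_real (exp (- (\<xi> \<bullet> v)\<^sup>2 / 2))" for \<xi>
  have \<gamma>: "\<gamma> \<xi> = (\<integral>u. character (u *\<^sub>R v) \<xi> \<partial>std_normal_distribution)" for \<xi>
    by (simp add: \<gamma>_def integral_character_std_normal)
  define \<rho> where "\<rho> u = exp (c * u - c\<^sup>2 / 2)" for u
  define D where "D = exp ((b\<^sup>2 - b) * c\<^sup>2 / 2)"
  \<comment> \<open>the right-hand side minus the left-hand side, with \<open>u\<close> integrated out, as a polynomial in \<open>x\<close>\<close>
  define L where "L = map (\<lambda>(d, \<xi>). (d * (- 1 * (character (c *\<^sub>R v) \<xi> * \<gamma> \<xi>)), \<xi>)) P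
    @ map (\<lambda>(d, \<xi>). (d * \<gamma> \<xi>, \<xi>)) Q @ [(complex_of_real (K * D), 0)]"
  have L: "trig_eval L \<psi> = - trig_eval P (\<lambda>\<xi>. character (c *\<^sub>R v) \<xi> * (\<psi> \<xi> * \<gamma> \<xi>))
      + trig_eval Q (\<lambda>\<xi>. \<psi> \<xi> * \<gamma> \<xi>) + K * D * \<psi> 0" for \<psi> :: "'a \<Rightarrow> complex"
    unfolding L_def trig_eval_append trig_eval_map_mult mult.assoc trig_eval_scale
    by (simp add: mult_ac)
  have "0 \<le> Re (trig_eval L (character x))" for x
  proof -
    let ?y = "\<lambda>u. x + u *\<^sub>R v"
    have ch: "(\<integral>u. character (z + u *\<^sub>R v) \<xi> \<partial>std_normal_distribution) = character z \<xi> * \<gamma> \<xi>" for z \<xi>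
      by (simp add: character_add \<gamma>)
    have mP: "(\<lambda>u. trig_eval P (character (?y u))) \<in> borel_measurable borel" by measurable
    have "trig_eval P (\<lambda>\<xi>. character (c *\<^sub>R v) \<xi> * (character x \<xi> * \<gamma> \<xi>))
        = trig_eval P (\<lambda>\<xi>. \<integral>u. character ((x + c *\<^sub>R v) + u *\<^sub>R v) \<xi> \<partial>std_normal_distribution)"
      by (simp only: ch) (simp only: character_add mult_ac)
    also have "\<dots> = (\<integral>u. trig_eval P (character (?y (c + u))) \<partial>std_normal_distribution)"
      by (subst N.integral_trig_eval[symmetric]) (simp_all add: algebra_simps)
    also have "\<dots> = (\<integral>u. \<rho> u *\<^sub>R trig_eval P (character (?y u)) \<partial>std_normal_distribution)"
      unfolding \<rho>_def by (rule std_normal_shift[OF mP, symmetric])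
    finally have 1: "trig_eval P (\<lambda>\<xi>. character (c *\<^sub>R v) \<xi> * (character x \<xi> * \<gamma> \<xi>)) = \<dots>" .
    have i1: "integrable std_normal_distribution (\<lambda>u. \<rho> u *\<^sub>R trig_eval P (character (?y u)))"
      unfolding \<rho>_def by (subst std_normal_shift_integrable[OF mP]) (intro N.integrable_trig_eval, simp)
    have 2: "trig_eval Q (\<lambda>\<xi>. character x \<xi> * \<gamma> \<xi>) = (\<integral>u. trig_eval Q (character (?y u)) \<partial>std_normal_distribution)"
      by (subst N.integral_trig_eval) (simp_all add: ch)
    have i2: "integrable std_normal_distribution (\<lambda>u. trig_eval Q (character (?y u)))"
      by (intro N.integrable_trig_eval) simp
    have "(\<integral>u. Re (\<rho> u *\<^sub>R trig_eval P (character (?y u))) \<partial>std_normal_distribution)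
        \<le> (\<integral>u. Re (trig_eval Q (character (?y u))) + K * exp (b * (c * u - c\<^sup>2 / 2)) \<partial>std_normal_distribution)"
      using i1 i2 std_normal_moment_integrable[of b c] le
      by (intro integral_mono integrable_add integrable_mult_right integrable_Re)
        (auto simp: P Q \<rho>_def mult.commute)
    also have "\<dots> = (\<integral>u. Re (trig_eval Q (character (?y u))) \<partial>std_normal_distribution) + K * D"
      using i2 std_normal_moment_integrable[of b c] by (simp add: std_normal_moment D_def)
    finally have "Re (\<integral>u. \<rho> u *\<^sub>R trig_eval P (character (?y u)) \<partial>std_normal_distribution)
        \<le> Re (\<integral>u. trig_eval Q (character (?y u)) \<partial>std_normal_distribution) + K * D"
      using integral_Re[OF i1] integral_Re[OF i2] by simp
    then show ?thesis unfolding L[of "character x"] 1 2 by simp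
  qed
  from trig_positiveD[OF \<phi> this] have *: "0 \<le> Re (trig_eval L \<phi>)" .
  have \<phi>0: "\<phi> 0 = 1" using \<mu>\<phi>[of 0] by (simp add: prob_space)
  have "trig_eval P (\<lambda>\<xi>. character (c *\<^sub>R v) \<xi> * (\<phi> \<xi> * \<gamma> \<xi>)) = (\<integral>x. trig_eval P (character (x + c *\<^sub>R v)) \<partial>\<mu>)"
    by (subst integral_trig_eval) (simp_all add: character_add \<mu>\<phi> \<gamma>_def mult.commute)
  then have 1: "Re (trig_eval P (\<lambda>\<xi>. character (c *\<^sub>R v) \<xi> * (\<phi> \<xi> * \<gamma> \<xi>))) = (\<integral>x. f (x + c *\<^sub>R v) \<partial>\<mu>)"
    using integrable_trig_eval[of "\<lambda>x. x + c *\<^sub>R v" P] by (simp add: P integral_Re)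
  have "trig_eval Q (\<lambda>\<xi>. \<phi> \<xi> * \<gamma> \<xi>) = (\<integral>x. trig_eval Q (character x) \<partial>\<mu>)"
    by (subst integral_trig_eval) (simp_all add: \<mu>\<phi> \<gamma>_def)
  then have 2: "Re (trig_eval Q (\<lambda>\<xi>. \<phi> \<xi> * \<gamma> \<xi>)) = (\<integral>x. p x \<partial>\<mu>)"
    using integrable_trig_eval[of "\<lambda>x. x" Q] by (simp add: Q integral_Re)
  show ?thesis using * by (simp add: L 1 2 \<phi>0 D_def)
qed

text \<open>
  Young's inequality \<open>y \<rho> \<le> (l y)\<^sup>\<alpha> / \<alpha> + (\<rho> / l)\<^sup>\<beta> / \<beta>\<close> supplies the pointwise hypothesis of the
  previous lemma for \<open>y = \<phi> (g x)\<close>. In general neither \<open>\<phi> (g x)\<close> nor its power is a trigonometric polynomial,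
  so the first is approximated from below and the second from above. The parameter \<open>l\<close> is kept free and
  optimised at the end.
\<close>

lemma shift_inequality_continuous:
  fixes \<mu> :: "'a::{real_inner, second_countable_topology} measure"
  assumes \<mu>: "borel_prob \<mu>" "gaussian_split \<mu> v"
    and g: "trig_poly g"
    and \<phi>: "continuous_on UNIV \<phi>" "\<And>y. 0 \<le> \<phi> y"
    and \<alpha>: "\<alpha> > 1" "\<beta> > 1" "1 / \<alpha> + 1 / \<beta> = 1" and l: "l > 0"
  shows "(\<integral>x. \<phi> (g (x + c *\<^sub>R v)) \<partial>\<mu>)
    \<le> (\<integral>x. (l * \<phi> (g x)) powr \<alpha> / \<alpha> \<partial>\<mu>) + (1 / l) powr \<beta> / \<beta> * exp ((\<beta>\<^sup>2 - \<beta>) * c\<^sup>2 / 2)"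
proof (rule field_le_epsilon)
  fix e :: real assume e: "0 < e"
  have [measurable_cong]: "sets \<mu> = sets borel" using \<mu> by (simp add: borel_prob_def)
  interpret prob_space \<mu> using \<mu> by (simp add: borel_prob_def)
  define K where "K = (1 / l) powr \<beta> / \<beta>"
  define D where "D = exp ((\<beta>\<^sup>2 - \<beta>) * c\<^sup>2 / 2)"
  let ?\<phi>' = "\<lambda>y. (l * \<phi> y) powr \<alpha> / \<alpha>"
  have \<phi>': "continuous_on UNIV ?\<phi>'"
    using \<alpha> l \<phi> by (intro continuous_intros continuous_on_powr') auto
  obtain q where q: "trig_poly q" "\<And>x. \<bar>\<phi> (g x) - q x\<bar> < e / 4"
    using trig_poly_uniform_approximation[OF g \<phi>(1), of "e / 4"] e by auto
  obtain r where r: "trig_poly r" "\<And>x. \<bar>?\<phi>' (g x) - r x\<bar> < e / 4"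
    using trig_poly_uniform_approximation[OF g \<phi>', of "e / 4"] e by auto
  have [measurable]: "g \<in> borel_measurable borel" "q \<in> borel_measurable borel" "r \<in> borel_measurable borel"
    using g q r by (auto intro: trig_poly_measurable)
  have [measurable]: "\<phi> \<in> borel_measurable borel" by (rule borel_measurable_continuous_onI[OF \<phi>(1)])
  have int: "integrable \<mu> h" if h: "h \<in> borel_measurable borel" and hh: "\<And>x. \<bar>h x - h' x\<bar> < e / 4" and h': "trig_poly h'"
    for h h'
  proof -
    obtain B where B: "\<And>x. \<bar>h' x\<bar> \<le> B" using trig_poly_bounded[OF h'] by blast
    have "\<bar>h x\<bar> \<le> B + e / 4" for x using B[of x] hh[of x] by (smt (verit) abs_triangle_ineq2)
    then show ?thesis using h by (intro integrable_const_bound[of _ "B + e / 4"]) auto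
  qed
  have ints: "integrable \<mu> (\<lambda>x. q x)" "integrable \<mu> (\<lambda>x. r x)" "integrable \<mu> (\<lambda>x. ?\<phi>' (g x))"
    by (rule int[OF _ _ q(1)] int[OF _ _ r(1)]; use e r(2) in simp)+
  have ints': "integrable \<mu> (\<lambda>x. q (x + c *\<^sub>R v))" "integrable \<mu> (\<lambda>x. \<phi> (g (x + c *\<^sub>R v)))"
  proof -
    obtain B where B: "\<And>x. \<bar>q x\<bar> \<le> B" using trig_poly_bounded[OF q(1)] by blast
    then show "integrable \<mu> (\<lambda>x. q (x + c *\<^sub>R v))" by (intro integrable_const_bound[of _ B]) auto
    have "\<bar>\<phi> (g x)\<bar> \<le> B + e / 4" for x using q(2)[of x] B[of x] by linarith
    then show "integrable \<mu> (\<lambda>x. \<phi> (g (x + c *\<^sub>R v)))"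
      by (intro integrable_const_bound[of _ "B + e / 4"]) auto
  qed
  have "(\<integral>x. \<phi> (g (x + c *\<^sub>R v)) \<partial>\<mu>) \<le> (\<integral>x. q (x + c *\<^sub>R v) + (- (e / 4) + e / 2) \<partial>\<mu>)"
  proof (rule integral_mono)
    show "integrable \<mu> (\<lambda>x. q (x + c *\<^sub>R v) + (- (e / 4) + e / 2))" using ints' by simp
    show "\<phi> (g (x + c *\<^sub>R v)) \<le> q (x + c *\<^sub>R v) + (- (e / 4) + e / 2)" for x
      using q(2)[of "x + c *\<^sub>R v"] by linarith
  qed (rule ints')
  also have "\<dots> = (\<integral>x. q (x + c *\<^sub>R v) + - (e / 4) \<partial>\<mu>) + e / 2"
    using ints' by (simp add: prob_space)
  also have "(\<integral>x. q (x + c *\<^sub>R v) + - (e / 4) \<partial>\<mu>) \<le> (\<integral>x. r x + e / 4 \<partial>\<mu>) + K * D"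
    unfolding D_def
  proof (rule shift_inequality_trig[OF \<mu>, of "\<lambda>x. q x + - (e / 4)"])
    fix x u
    let ?\<rho> = "exp (c * u - c\<^sup>2 / 2)"
    have "(q x + - (e / 4)) * ?\<rho> \<le> \<phi> (g x) * ?\<rho>"
    proof (rule mult_right_mono)
      show "q x + - (e / 4) \<le> \<phi> (g x)" using q(2)[of x] by linarith
    qed simp
    also have "\<dots> = (l * \<phi> (g x)) * (?\<rho> / l)" using l by simp
    also have "\<dots> \<le> ?\<phi>' (g x) + (?\<rho> / l) powr \<beta> / \<beta>"
      using l \<phi>(2) by (intro Youngs_inequality \<alpha>) auto
    also have "(?\<rho> / l) powr \<beta> / \<beta> = K * exp (\<beta> * (c * u - c\<^sup>2 / 2))"
      using l by (simp add: K_def powr_divide exp_powr_real mult.commute)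
    also have "?\<phi>' (g x) \<le> r x + e / 4" using r(2)[of x] by linarith
    finally show "(q x + - (e / 4)) * ?\<rho> \<le> r x + e / 4 + K * exp (\<beta> * (c * u - c\<^sup>2 / 2))" by simp
  qed (intro trig_poly_add trig_poly_const q(1) r(1))+
  also have "(\<integral>x. r x + e / 4 \<partial>\<mu>) \<le> (\<integral>x. ?\<phi>' (g x) + e / 2 \<partial>\<mu>)"
  proof (rule integral_mono)
    show "r x + e / 4 \<le> ?\<phi>' (g x) + e / 2" for x using r(2)[of x] by linarith
  qed (use ints in simp_all)
  also have "\<dots> = (\<integral>x. ?\<phi>' (g x) \<partial>\<mu>) + e / 2" using ints by (simp add: prob_space)
  finally show "(\<integral>x. \<phi> (g (x + c *\<^sub>R v)) \<partial>\<mu>)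
    \<le> (\<integral>x. (l * \<phi> (g x)) powr \<alpha> / \<alpha> \<partial>\<mu>) + (1 / l) powr \<beta> / \<beta> * exp ((\<beta>\<^sup>2 - \<beta>) * c\<^sup>2 / 2) + e"
    by (simp add: K_def D_def)
qed

section \<open>Density of trigonometric polynomials\<close>

text \<open>
  A norm bound is a family of linear inequalities, and a dense set of directions suffices.
  When \<open>D\<close> is countable this makes balls measurable in terms of inner products.
\<close>

lemma cball_eq_halfspaces:
  fixes a :: "'a::real_inner"
  assumes D: "closure D = (UNIV :: 'a set)" and r: "0 \<le> r"
  shows "cball a r = (\<Inter>d\<in>D. {x. d \<bullet> x \<le> r * norm d + d \<bullet> a})"
proof (intro set_eqI iffI)
  fix x assume "x \<in> cball a r"
  then have x: "norm (x - a) \<le> r" by (simp add: dist_norm norm_minus_commute)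
  have "d \<bullet> (x - a) \<le> r * norm d" for d
    using norm_cauchy_schwarz[of d "x - a"] mult_left_mono[OF x, of "norm d"]
    by (simp add: mult.commute)
  then show "x \<in> (\<Inter>d\<in>D. {x. d \<bullet> x \<le> r * norm d + d \<bullet> a})"
    by (simp add: inner_diff_right diff_le_eq)
next
  fix x assume x: "x \<in> (\<Inter>d\<in>D. {x. d \<bullet> x \<le> r * norm d + d \<bullet> a})"
  have "closed {d. d \<bullet> (x - a) \<le> r * norm d}"
    by (intro closed_Collect_le continuous_intros)
  then have "closure D \<subseteq> {d. d \<bullet> (x - a) \<le> r * norm d}"
    using x by (intro closure_minimal) (auto simp: inner_diff_right diff_le_eq)
  then have "(x - a) \<bullet> (x - a) \<le> r * norm (x - a)" using D by auto
  then have "norm (x - a) * norm (x - a) \<le> r * norm (x - a)"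
    by (simp add: dot_square_norm power2_eq_square)
  then have "norm (x - a) \<le> r" using r by (cases "x = a") simp_all
  then show "x \<in> cball a r" by (simp add: dist_norm norm_minus_commute)
qed

text \<open>
  In a separable space every open set is a countable union of balls with centres in a countable dense
  set, and each of these balls is a countable intersection of half-spaces.
\<close>

lemma borel_subset_if_inner_measurable:
  fixes S :: "'a::{real_inner, second_countable_topology} measure"
  assumes space: "space S = UNIV" and inner: "\<And>\<xi>. (\<lambda>x. \<xi> \<bullet> x) \<in> borel_measurable S"
  shows "sets borel \<subseteq> sets S"
proof -
  obtain D :: "'a set" where D: "countable D" "\<And>X. open X \<Longrightarrow> X \<noteq> {} \<Longrightarrow> \<exists>d\<in>D. d \<in> X"
    using countable_dense_exists[where 'a='a] by metis
  have clD: "closure D = UNIV"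
    using D(2)[of "- closure D"] closure_subset[of D] by blast
  have halfspace: "{x. d \<bullet> x \<le> b} \<in> sets S" for d b
    using measurable_sets[OF inner[of d], of "{..b}"] by (simp add: space vimage_def)
  have cball: "cball a r \<in> sets S" if "0 \<le> r" for a :: 'a and r
    unfolding cball_eq_halfspaces[OF clD that] using D(1) clD
    by (intro sets.countable_INT') (auto intro: halfspace)
  have "X \<in> sets S" if X: "open X" for X :: "'a set"
  proof -
    let ?I = "{p \<in> D \<times> (UNIV :: nat set). cball (fst p) (inverse (real (Suc (snd p)))) \<subseteq> X}"
    have "X \<subseteq> (\<Union>p\<in>?I. cball (fst p) (inverse (real (Suc (snd p)))))"
    proof
      fix x assume "x \<in> X"
      then obtain e where e: "0 < e" "ball x e \<subseteq> X" using X open_contains_ball by blast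
      obtain n where n: "inverse (real (Suc n)) < e / 2" using reals_Archimedean[of "e / 2"] e by auto
      obtain d where d: "d \<in> D" "d \<in> ball x (inverse (real (Suc n)))"
        using D(2)[of "ball x (inverse (real (Suc n)))"] by (auto simp del: of_nat_Suc)
      have "cball d (inverse (real (Suc n))) \<subseteq> ball x e"
      proof
        fix y assume "y \<in> cball d (inverse (real (Suc n)))"
        then show "y \<in> ball x e" using d(2) n dist_triangle[of x y d] by simp
      qed
      then have "(d, n) \<in> ?I" using d(1) e(2) by auto
      moreover have "x \<in> cball d (inverse (real (Suc n)))" using d(2) by (simp add: dist_commute)
      ultimately show "x \<in> (\<Union>p\<in>?I. cball (fst p) (inverse (real (Suc (snd p)))))" by force
    qed
    then have "X = (\<Union>p\<in>?I. cball (fst p) (inverse (real (Suc (snd p)))))" by auto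
    also have "\<dots> \<in> sets S"
      using D(1) by (intro sets.countable_UN' countable_Collect countable_SIGMA) (auto intro!: cball)
    finally show ?thesis .
  qed
  then have "sigma_sets (space S) {X. open X} \<subseteq> sets S"
    by (intro sets.sigma_sets_subset) auto
  then show ?thesis by (simp add: borel_def space)
qed

lemma trig_poly_sin: "trig_poly (\<lambda>x. sin (\<eta> \<bullet> x))"
  unfolding trig_poly_def
  by (rule exI[of _ "[(- \<i>, \<eta>)]"]) (simp add: character_def Im_exp)

text \<open>
  The comparison of a measure with its translate needs approximations that are good for both
  measures at once, hence a pair of measures.
\<close>

locale two_finite_borel_measures =
  M: finite_measure M + N: finite_measure N
  for M N :: "'a::{real_inner, second_countable_topology} measure" +
  assumes sets_M [measurable_cong]: "sets M = sets borel" and sets_N [measurable_cong]: "sets N = sets borel"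
begin

definition bounded_borel :: "('a \<Rightarrow> real) \<Rightarrow> bool" where
  "bounded_borel f \<longleftrightarrow> f \<in> borel_measurable borel \<and> bounded (range f)"

definition L1 :: "('a \<Rightarrow> real) \<Rightarrow> real" where
  "L1 f = (\<integral>x. \<bar>f x\<bar> \<partial>M) + (\<integral>x. \<bar>f x\<bar> \<partial>N)"

text \<open>
  Membership in the closure of the trigonometric polynomials, among bounded Borel functions, for the
  sum of both \<open>L\<^sup>1\<close>-seminorms.
\<close>

definition trig_approx :: "('a \<Rightarrow> real) \<Rightarrow> bool" where
  "trig_approx f \<longleftrightarrow> bounded_borel f \<and>
     (\<exists>p. (\<forall>n. trig_poly (p n)) \<and> (\<lambda>n. L1 (\<lambda>x. f x - p n x)) \<longlonglongrightarrow> 0)"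

lemma bounded_borelI: "f \<in> borel_measurable borel \<Longrightarrow> (\<And>x. \<bar>f x\<bar> \<le> B) \<Longrightarrow> bounded_borel f"
  by (auto simp: bounded_borel_def bounded_iff)

lemma bounded_borelE:
  assumes "bounded_borel f" obtains B where "0 \<le> B" "\<And>x. \<bar>f x\<bar> \<le> B"
  using assms unfolding bounded_borel_def bounded_pos by (auto intro: less_imp_le)

lemma bounded_borel_lincomb:
  assumes "bounded_borel f" "bounded_borel g" shows "bounded_borel (\<lambda>x. a * f x + b * g x)"
proof -
  obtain A B where "\<And>x. \<bar>f x\<bar> \<le> A" "\<And>x. \<bar>g x\<bar> \<le> B" using assms by (meson bounded_borelE)
  then have "\<bar>a * f x + b * g x\<bar> \<le> \<bar>a\<bar> * A + \<bar>b\<bar> * B" for x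
    by (intro order_trans[OF abs_triangle_ineq] add_mono) (auto simp: abs_mult intro: mult_left_mono)
  then show ?thesis using assms by (intro bounded_borelI) (auto simp: bounded_borel_def)
qed

lemma bounded_borel_diff: "bounded_borel f \<Longrightarrow> bounded_borel g \<Longrightarrow> bounded_borel (\<lambda>x. f x - g x)"
  using bounded_borel_lincomb[of f g 1 "-1"] by simp

lemma bounded_borel_mult:
  assumes "bounded_borel f" "bounded_borel g" shows "bounded_borel (\<lambda>x. f x * g x)"
proof -
  obtain A B where AB: "\<And>x. \<bar>f x\<bar> \<le> A" "0 \<le> A" "\<And>x. \<bar>g x\<bar> \<le> B" using assms by (meson bounded_borelE)
  then have "\<bar>f x * g x\<bar> \<le> A * B" for x by (auto simp: abs_mult intro!: mult_mono)
  then show ?thesis using assms by (intro bounded_borelI) (auto simp: bounded_borel_def)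
qed

lemma bounded_borel_trig_poly: "trig_poly g \<Longrightarrow> bounded_borel g"
  by (meson bounded_borelI trig_poly_bounded trig_poly_measurable)

lemma integrable_bounded_borel:
  assumes "bounded_borel f" shows "integrable M f" "integrable N f"
proof -
  obtain B where "\<And>x. \<bar>f x\<bar> \<le> B" using assms by (meson bounded_borelE)
  then show "integrable M f" "integrable N f"
    using assms by (auto intro!: M.integrable_const_bound[of _ B] N.integrable_const_bound[of _ B]
        simp: bounded_borel_def)
qed

lemma L1_nonneg: "0 \<le> L1 f"
  by (simp add: L1_def)

text \<open>
  All estimates of the distance below reduce to this combination of monotonicity and the triangle
  inequality.
\<close>

lemma L1_le:
  assumes "bounded_borel f" "bounded_borel g" "bounded_borel h"
    and "\<And>x. \<bar>h x\<bar> \<le> a * \<bar>f x\<bar> + b * \<bar>g x\<bar>"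
  shows "L1 h \<le> a * L1 f + b * L1 g"
proof -
  note int = assms(1-3)[THEN integrable_bounded_borel(1)] assms(1-3)[THEN integrable_bounded_borel(2)]
  have "(\<integral>x. \<bar>h x\<bar> \<partial>M) \<le> (\<integral>x. a * \<bar>f x\<bar> + b * \<bar>g x\<bar> \<partial>M)"
    "(\<integral>x. \<bar>h x\<bar> \<partial>N) \<le> (\<integral>x. a * \<bar>f x\<bar> + b * \<bar>g x\<bar> \<partial>N)"
    by (intro integral_mono assms(4); use int in simp)+
  then show ?thesis using int by (simp add: L1_def algebra_simps)
qed

lemma L1_tendsto_zero:
  assumes bb: "\<And>n. bounded_borel (F n)" and B: "\<And>n x. \<bar>F n x\<bar> \<le> B" and lim: "\<And>x. (\<lambda>n. F n x) \<longlonglongrightarrow> 0"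
  shows "(\<lambda>n. L1 (F n)) \<longlonglongrightarrow> 0"
proof -
  have [measurable]: "F n \<in> borel_measurable borel" for n using bb by (simp add: bounded_borel_def)
  have "(\<lambda>n. \<integral>x. \<bar>F n x\<bar> \<partial>M) \<longlonglongrightarrow> (\<integral>x. 0 \<partial>M)" "(\<lambda>n. \<integral>x. \<bar>F n x\<bar> \<partial>N) \<longlonglongrightarrow> (\<integral>x. 0 \<partial>N)"
    by (rule integral_dominated_convergence[where w="\<lambda>_. B"]; use B lim in \<open>simp add: tendsto_rabs_zero\<close>)+
  from tendsto_add[OF this] show ?thesis by (simp add: L1_def)
qed

lemma trig_approx_bounded_borel: "trig_approx f \<Longrightarrow> bounded_borel f"
  by (simp add: trig_approx_def)

lemma trig_approx_closed:
  assumes f: "bounded_borel f" and F: "\<And>n. trig_approx (F n)" and lim: "(\<lambda>n. L1 (\<lambda>x. f x - F n x)) \<longlonglongrightarrow> 0"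
  shows "trig_approx f"
proof -
  have "\<exists>p. trig_poly p \<and> L1 (\<lambda>x. F n x - p x) < inverse (real (Suc n))" for n
  proof -
    obtain p where p: "\<And>k. trig_poly (p k)" "(\<lambda>k. L1 (\<lambda>x. F n x - p k x)) \<longlonglongrightarrow> 0"
      using F[of n] by (auto simp: trig_approx_def)
    from order_tendstoD(2)[OF p(2), of "inverse (real (Suc n))"] show ?thesis
      using p(1) by (auto simp: eventually_sequentially simp del: of_nat_Suc)
  qed
  then obtain p where p: "\<And>n. trig_poly (p n)" "\<And>n. L1 (\<lambda>x. F n x - p n x) < inverse (real (Suc n))"
    by metis
  have "L1 (\<lambda>x. f x - p n x) \<le> 1 * L1 (\<lambda>x. f x - F n x) + 1 * L1 (\<lambda>x. F n x - p n x)" for n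
    by (intro L1_le bounded_borel_diff f trig_approx_bounded_borel[OF F] bounded_borel_trig_poly[OF p(1)]) simp
  then have le: "L1 (\<lambda>x. f x - p n x) \<le> L1 (\<lambda>x. f x - F n x) + inverse (real (Suc n))" for n
    by (rule order_trans) (use p(2)[of n] in simp)
  have "(\<lambda>n. L1 (\<lambda>x. f x - F n x) + inverse (real (Suc n))) \<longlonglongrightarrow> 0"
    using tendsto_add[OF lim LIMSEQ_inverse_real_of_nat] by simp
  then have "(\<lambda>n. L1 (\<lambda>x. f x - p n x)) \<longlonglongrightarrow> 0"
    by (rule tendsto_sandwich[OF _ _ tendsto_const, rotated 2])
      (intro always_eventually allI L1_nonneg le)+
  then show ?thesis using f p(1) by (auto simp: trig_approx_def)
qed

lemma trig_approx_bounded_limit: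
  assumes F: "\<And>n. trig_approx (F n)" and B: "\<And>n x. \<bar>F n x\<bar> \<le> B" and lim: "\<And>x. (\<lambda>n. F n x) \<longlonglongrightarrow> f x"
  shows "trig_approx f"
proof (rule trig_approx_closed[OF _ F])
  have m: "F n \<in> borel_measurable borel" for n using F by (simp add: trig_approx_def bounded_borel_def)
  have fB: "\<bar>f x\<bar> \<le> B" for x by (rule LIMSEQ_le_const2[OF tendsto_rabs[OF lim]]) (use B in auto)
  show f: "bounded_borel f" by (rule bounded_borelI[OF borel_measurable_LIMSEQ_real[OF lim m] fB])
  show "(\<lambda>n. L1 (\<lambda>x. f x - F n x)) \<longlonglongrightarrow> 0"
  proof (rule L1_tendsto_zero[of _ "2 * B"])
    show "\<bar>f x - F n x\<bar> \<le> 2 * B" for n x using fB[of x] B[of n x] by linarith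
    show "(\<lambda>n. f x - F n x) \<longlonglongrightarrow> 0" for x
      using tendsto_diff[OF tendsto_const lim, of "f x" x] by simp
  qed (intro bounded_borel_diff f trig_approx_bounded_borel F)
qed

lemma trig_approx_trig_poly: "trig_poly g \<Longrightarrow> trig_approx g"
  unfolding trig_approx_def by (auto intro: bounded_borel_trig_poly intro!: exI[of _ "\<lambda>_. g"] simp: L1_def)

lemma trig_approx_lincomb:
  assumes "trig_approx f" "trig_approx g" shows "trig_approx (\<lambda>x. a * f x + b * g x)"
proof -
  obtain p q where p: "\<And>n. trig_poly (p n)" "(\<lambda>n. L1 (\<lambda>x. f x - p n x)) \<longlonglongrightarrow> 0"
    and q: "\<And>n. trig_poly (q n)" "(\<lambda>n. L1 (\<lambda>x. g x - q n x)) \<longlonglongrightarrow> 0"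
    using assms by (auto simp: trig_approx_def)
  have bb: "bounded_borel f" "bounded_borel g" "bounded_borel (p n)" "bounded_borel (q n)" for n
    using assms p q by (auto intro: trig_approx_bounded_borel bounded_borel_trig_poly)
  have ineq: "\<bar>(a * f x + b * g x) - (a * p n x + b * q n x)\<bar> \<le> \<bar>a\<bar> * \<bar>f x - p n x\<bar> + \<bar>b\<bar> * \<bar>g x - q n x\<bar>" for n x
    unfolding abs_mult[symmetric]
    using abs_triangle_ineq[of "a * (f x - p n x)" "b * (g x - q n x)"] by (simp add: algebra_simps)
  have le: "L1 (\<lambda>x. (a * f x + b * g x) - (a * p n x + b * q n x))
      \<le> \<bar>a\<bar> * L1 (\<lambda>x. f x - p n x) + \<bar>b\<bar> * L1 (\<lambda>x. g x - q n x)" for n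
    by (intro L1_le ineq bounded_borel_diff bounded_borel_lincomb bb)
  have "(\<lambda>n. \<bar>a\<bar> * L1 (\<lambda>x. f x - p n x) + \<bar>b\<bar> * L1 (\<lambda>x. g x - q n x)) \<longlonglongrightarrow> 0"
    using p(2) q(2) by (auto intro!: tendsto_eq_intros)
  then have "(\<lambda>n. L1 (\<lambda>x. (a * f x + b * g x) - (a * p n x + b * q n x))) \<longlonglongrightarrow> 0"
    by (rule tendsto_sandwich[OF _ _ tendsto_const, rotated 2])
      (intro always_eventually allI L1_nonneg le)+
  then show ?thesis
    by (rule trig_approx_closed[where F="\<lambda>n x. a * p n x + b * q n x", rotated 2])
      (intro bounded_borel_lincomb bb trig_approx_trig_poly trig_poly_add trig_poly_mult trig_poly_const p q)+
qed

text \<open>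
  Approximations are not uniformly bounded, so the factors are approximated one after the other,
  each time with the other factor fixed and bounded.
\<close>

lemma trig_approx_mult_step:
  assumes "trig_approx f" "bounded_borel g" and "\<And>p. trig_poly p \<Longrightarrow> trig_approx (\<lambda>x. p x * g x)"
  shows "trig_approx (\<lambda>x. f x * g x)"
proof -
  obtain p where p: "\<And>n. trig_poly (p n)" "(\<lambda>n. L1 (\<lambda>x. f x - p n x)) \<longlonglongrightarrow> 0"
    using assms by (auto simp: trig_approx_def)
  have bb: "bounded_borel f" "bounded_borel g" "bounded_borel (p n)" for n
    using assms p by (auto intro: trig_approx_bounded_borel bounded_borel_trig_poly)
  obtain B where B: "0 \<le> B" "\<And>x. \<bar>g x\<bar> \<le> B" using bb(2) by (meson bounded_borelE)
  have ineq: "\<bar>f x * g x - p n x * g x\<bar> \<le> B * \<bar>f x - p n x\<bar> + 0 * \<bar>f x - p n x\<bar>" for n x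
    using mult_right_mono[OF B(2)[of x], of "\<bar>f x - p n x\<bar>"]
    unfolding left_diff_distrib[symmetric] abs_mult by (simp add: mult.commute)
  have le: "L1 (\<lambda>x. f x * g x - p n x * g x) \<le> B * L1 (\<lambda>x. f x - p n x) + 0 * L1 (\<lambda>x. f x - p n x)" for n
    by (intro L1_le ineq bounded_borel_diff bounded_borel_mult bb)
  have "(\<lambda>n. B * L1 (\<lambda>x. f x - p n x) + 0 * L1 (\<lambda>x. f x - p n x)) \<longlonglongrightarrow> 0"
    using p(2) by (auto intro!: tendsto_eq_intros)
  then have "(\<lambda>n. L1 (\<lambda>x. f x * g x - p n x * g x)) \<longlonglongrightarrow> 0"
    by (rule tendsto_sandwich[OF _ _ tendsto_const, rotated 2])
      (intro always_eventually allI L1_nonneg le)+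
  then show ?thesis
    by (rule trig_approx_closed[where F="\<lambda>n x. p n x * g x", rotated 2])
      (intro bounded_borel_mult bb assms(3) p)+
qed

lemma trig_approx_mult:
  assumes "trig_approx f" "trig_approx g" shows "trig_approx (\<lambda>x. f x * g x)"
proof (rule trig_approx_mult_step[OF assms(1)])
  show "bounded_borel g" using assms(2) by (rule trig_approx_bounded_borel)
  fix p :: "'a \<Rightarrow> real" assume p: "trig_poly p"
  have "trig_approx (\<lambda>x. g x * p x)"
    by (rule trig_approx_mult_step[OF assms(2)]) (auto intro: p bounded_borel_trig_poly trig_approx_trig_poly trig_poly_mult)
  then show "trig_approx (\<lambda>x. p x * g x)" by (simp add: mult.commute)
qed

lemma trig_approx_continuous_trig_poly:
  assumes g: "trig_poly g" and \<phi>: "continuous_on UNIV (\<phi> :: real \<Rightarrow> real)"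
  shows "trig_approx (\<lambda>x. \<phi> (g x))"
proof -
  have "\<exists>q. trig_poly q \<and> (\<forall>x. \<bar>\<phi> (g x) - q x\<bar> < inverse (real (Suc n)))" for n
    by (rule trig_poly_uniform_approximation[OF g \<phi>, of "inverse (real (Suc n))"]) auto
  then obtain q where q: "\<And>n. trig_poly (q n)" "\<And>n x. \<bar>\<phi> (g x) - q n x\<bar> < inverse (real (Suc n))"
    by metis
  obtain B where B: "\<And>x. \<bar>q 0 x\<bar> \<le> B" using trig_poly_bounded[OF q(1)] by blast
  show ?thesis
  proof (rule trig_approx_bounded_limit)
    show "trig_approx (q n)" for n by (intro trig_approx_trig_poly q)
    show "\<bar>q n x\<bar> \<le> B + 2" for n x
    proof -
      have "inverse (real (Suc n)) \<le> 1" by (simp add: inverse_le_1_iff)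
      then show ?thesis using q(2)[of x n] q(2)[of x 0] B[of x] by simp
    qed
    have "(\<lambda>n. q n x - \<phi> (g x)) \<longlonglongrightarrow> 0" for x
      by (rule Lim_null_comparison[OF _ LIMSEQ_inverse_real_of_nat])
        (use q(2)[of x] in \<open>auto simp: abs_minus_commute intro!: always_eventually less_imp_le simp del: of_nat_Suc\<close>)
    then show "(\<lambda>n. q n x) \<longlonglongrightarrow> \<phi> (g x)" for x by (rule LIM_zero_cancel)
  qed
qed

definition trig_approx_sets :: "'a set set" where
  "trig_approx_sets = {A. trig_approx (indicator A)}"

lemma sigma_algebra_trig_approx_sets: "sigma_algebra UNIV trig_approx_sets"
  unfolding sigma_algebra_iff2
proof (intro conjI ballI allI impI)
  have const: "trig_approx (\<lambda>x. r)" for r by (intro trig_approx_trig_poly) auto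
  have compl: "UNIV - A \<in> trig_approx_sets" if "A \<in> trig_approx_sets" for A
  proof -
    have "indicator (UNIV - A) = (\<lambda>x. 1 * 1 + (- 1) * indicator A x :: real)" by (auto simp: indicator_def)
    then show ?thesis using that trig_approx_lincomb[OF const[of 1], of "indicator A" 1 "-1"] by (simp add: trig_approx_sets_def)
  qed
  then show "UNIV - A \<in> trig_approx_sets" if "A \<in> trig_approx_sets" for A using that .
  have inter: "A \<inter> B \<in> trig_approx_sets" if "A \<in> trig_approx_sets" "B \<in> trig_approx_sets" for A B
  proof -
    have "indicator (A \<inter> B) = (\<lambda>x. indicator A x * indicator B x :: real)" by (auto simp: indicator_def)
    then show ?thesis using that trig_approx_mult by (simp add: trig_approx_sets_def)
  qed
  show empty: "{} \<in> trig_approx_sets"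
    using const[of 0] by (simp add: trig_approx_sets_def indicator_def[abs_def])
  fix A :: "nat \<Rightarrow> 'a set" assume A: "range A \<subseteq> trig_approx_sets"
  have fin: "(\<Union>i<n. A i) \<in> trig_approx_sets" for n
  proof (induction n)
    case 0 then show ?case using empty by simp
  next
    case (Suc n)
    have "(\<Union>i<Suc n. A i) = UNIV - ((UNIV - (\<Union>i<n. A i)) \<inter> (UNIV - A n))"
      by (auto simp: less_Suc_eq)
    then show ?case using Suc A by (auto intro!: compl inter simp: image_subset_iff simp del: Diff_UNIV)
  qed
  have "trig_approx (indicator (\<Union>i. A i))"
  proof (rule trig_approx_bounded_limit[of "\<lambda>n. indicator (\<Union>i<n. A i)" 1])
    show "trig_approx (indicator (\<Union>i<n. A i))" for n using fin[of n] by (simp add: trig_approx_sets_def)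
    show "(\<lambda>n. indicator (\<Union>i<n. A i) x :: real) \<longlonglongrightarrow> indicator (\<Union>i. A i) x" for x
      by (rule LIMSEQ_indicator_UN)
  qed (auto simp: indicator_def)
  then show "(\<Union>i. A i) \<in> trig_approx_sets" by (simp add: trig_approx_sets_def)
qed auto

text \<open>
  Continuous functions of trigonometric polynomials are approximable, hence so are the indicators of
  \<open>{g > r}\<close>, and trigonometric polynomials are measurable for the \<open>\<sigma>\<close>-algebra of approximable sets. The
  linear functionals are their limits, as \<open>n sin (\<langle>\<xi>, x\<rangle> / n) \<rightarrow> \<langle>\<xi>, x\<rangle>\<close>, and they generate the Borel sets.
\<close>

lemma borel_subset_trig_approx_sets: "sets borel \<subseteq> trig_approx_sets"
proof -
  define S where "S = sigma UNIV trig_approx_sets"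
  have S: "sets S = trig_approx_sets" "space S = UNIV"
    using sigma_algebra.sets_measure_of_eq[OF sigma_algebra_trig_approx_sets]
    by (simp_all add: S_def space_measure_of_conv)
  have trig: "g \<in> borel_measurable S" if g: "trig_poly g" for g
    unfolding borel_measurable_iff_greater
  proof (intro allI)
    fix r :: real
    have "trig_approx (indicator {x. r < g x})"
    proof (rule trig_approx_bounded_limit)
      let ?\<phi> = "\<lambda>n y. min 1 (real n * max 0 (y - r))"
      show "trig_approx (\<lambda>x. ?\<phi> n (g x))" for n
        by (intro trig_approx_continuous_trig_poly[OF g, of "?\<phi> n"] continuous_intros)
      show "\<bar>?\<phi> n (g x)\<bar> \<le> 1" for n x by (simp add: abs_le_iff)
      show "(\<lambda>n. ?\<phi> n (g x)) \<longlonglongrightarrow> indicator {x. r < g x} x" for x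
      proof (cases "r < g x")
        case True
        obtain k where k: "1 / (g x - r) < real k" using reals_Archimedean2 by blast
        have "?\<phi> n (g x) = 1" if "n \<ge> k" for n
        proof -
          have "1 < real k * (g x - r)" using k True by (simp add: divide_less_eq)
          also have "\<dots> \<le> real n * (g x - r)" using that True by (intro mult_right_mono) auto
          finally show ?thesis using True by simp
        qed
        then show ?thesis using True
          by (intro tendsto_eventually) (auto simp: eventually_sequentially)
      qed (simp add: max_def)
    qed
    then show "{w \<in> space S. r < g w} \<in> sets S" by (simp add: S trig_approx_sets_def)
  qed
  have "(\<lambda>x. \<xi> \<bullet> x) \<in> borel_measurable S" for \<xi>
  proof (rule borel_measurable_LIMSEQ_real)
    let ?s = "\<lambda>n x. real (Suc n) * sin (inverse (real (Suc n)) * (\<xi> \<bullet> x))"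
    have "trig_poly (\<lambda>x. sin (inverse (real (Suc n)) * (\<xi> \<bullet> x)))" for n
      using trig_poly_sin[of "inverse (real (Suc n)) *\<^sub>R \<xi>"] by (simp del: of_nat_Suc)
    then show "?s n \<in> borel_measurable S" for n
      by (intro trig trig_poly_mult trig_poly_const)
    show "(\<lambda>n. ?s n x) \<longlonglongrightarrow> \<xi> \<bullet> x" for x
    proof -
      have "((\<lambda>t. sin ((\<xi> \<bullet> x) * t)) has_real_derivative \<xi> \<bullet> x) (at 0)"
        by (auto intro!: derivative_eq_intros)
      then have "(\<lambda>h. sin ((\<xi> \<bullet> x) * h) / h) \<midarrow>0\<rightarrow> \<xi> \<bullet> x"
        by (simp add: DERIV_def)
      from filterlim_compose[OF this filterlim_atI[OF LIMSEQ_inverse_real_of_nat]]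
      show ?thesis by (simp add: divide_inverse mult.commute del: of_nat_Suc)
    qed
  qed
  then show ?thesis using borel_subset_if_inner_measurable[of S] S by simp
qed

lemma trig_approx_nonneg:
  assumes "bounded_borel f" "\<And>x. 0 \<le> f x" shows "trig_approx f"
proof -
  have "f \<in> borel_measurable borel" using assms(1) by (simp add: bounded_borel_def)
  then have "bounded_borel f \<longrightarrow> trig_approx f"
    using assms(2)
  proof (induction rule: borel_measurable_induct_real)
    case (set A)
    then show ?case using borel_subset_trig_approx_sets by (auto simp: trig_approx_sets_def)
  next
    case (mult u c)
    show ?case
    proof
      assume cu: "bounded_borel (\<lambda>x. c * u x)"
      show "trig_approx (\<lambda>x. c * u x)"
      proof (cases "c = 0")
        case True
        then show ?thesis by (auto intro: trig_approx_trig_poly)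
      next
        case False
        then have "bounded_borel u"
          using bounded_borel_lincomb[OF cu cu, of "1 / c" 0] by simp
        then show ?thesis using mult trig_approx_lincomb[of u u c 0] by simp
      qed
    qed
  next
    case (add u v)
    show ?case
    proof
      assume "bounded_borel (\<lambda>x. v x + u x)"
      then obtain B where B: "\<And>x. \<bar>v x + u x\<bar> \<le> B" by (meson bounded_borelE)
      have uv: "\<bar>u x\<bar> \<le> B" "\<bar>v x\<bar> \<le> B" for x using B[of x] \<open>\<And>x. 0 \<le> u x\<close>[of x] \<open>\<And>x. 0 \<le> v x\<close>[of x] by linarith+
      have "bounded_borel u" "bounded_borel v"
        by (rule bounded_borelI[OF _ uv(1)] bounded_borelI[OF _ uv(2)], fact)+
      then have "trig_approx u" "trig_approx v" using add by blast+
      from trig_approx_lincomb[OF this(2,1), of 1 1] show "trig_approx (\<lambda>x. v x + u x)" by simp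
    qed
  next
    case (seq U)
    show ?case
    proof
      assume "bounded_borel f"
      then obtain B where B: "\<And>x. \<bar>f x\<bar> \<le> B" by (meson bounded_borelE)
      have "U i x \<le> f x" for i x
        using incseq_le[of "\<lambda>i. U i x"] seq by (auto simp: incseq_def le_fun_def)
      then have UB: "\<bar>U i x\<bar> \<le> B" for i x using B[of x] seq(2)[of i x] by (smt (verit))
      have "bounded_borel (U i)" for i by (rule bounded_borelI[OF _ UB]) fact
      then have "trig_approx (U i)" for i using seq by blast
      then show "trig_approx f" by (rule trig_approx_bounded_limit[OF _ UB]) (use seq in auto)
    qed
  qed
  then show ?thesis using assms by blast
qed

lemma trig_approx_sequence:
  assumes "bounded_borel f" "\<And>x. 0 \<le> f x"
  obtains p where "\<And>n. trig_poly (p n)"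
    "(\<lambda>n. \<integral>x. \<bar>f x - p n x\<bar> \<partial>M) \<longlonglongrightarrow> 0" "(\<lambda>n. \<integral>x. \<bar>f x - p n x\<bar> \<partial>N) \<longlonglongrightarrow> 0"
proof -
  obtain p where p: "\<And>n. trig_poly (p n)" "(\<lambda>n. L1 (\<lambda>x. f x - p n x)) \<longlonglongrightarrow> 0"
    using trig_approx_nonneg[OF assms] by (auto simp: trig_approx_def)
  have "(\<lambda>n. \<integral>x. \<bar>f x - p n x\<bar> \<partial>M) \<longlonglongrightarrow> 0" "(\<lambda>n. \<integral>x. \<bar>f x - p n x\<bar> \<partial>N) \<longlonglongrightarrow> 0"
    by (rule tendsto_sandwich[OF _ _ tendsto_const p(2)]; simp add: L1_def)+
  then show ?thesis using that p(1) by blast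
qed

end

section \<open>The Harnack inequality\<close>

text \<open>
  Convexity of the power function bounds the difference by the tangent at \<open>a\<close>; here the tangent
  inequality is read off from Young's inequality.
\<close>

lemma powr_diff_le:
  fixes a b :: real
  assumes "0 \<le> a" "a \<le> B" "0 \<le> b" "p > 1"
  shows "a powr p - b powr p \<le> p * B powr (p - 1) * \<bar>a - b\<bar>"
proof -
  define q where "q = p / (p - 1)"
  have q: "q > 1" "1 / p + 1 / q = 1" "(p - 1) * q = p" using assms(4) by (auto simp: q_def field_simps)
  have "b * a powr (p - 1) \<le> b powr p / p + (a powr (p - 1)) powr q / q"
    using assms q by (intro Youngs_inequality) auto
  then have "b * a powr (p - 1) \<le> b powr p / p + a powr p / q"
    by (simp only: powr_powr q(3))
  also have "a powr p / q = a powr p * (1 / q)" by simp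
  also have "1 / q = 1 - 1 / p" using q(2) by simp
  also have "a powr p * (1 - 1 / p) = a powr p - a powr p / p" by (simp add: right_diff_distrib)
  finally have "p * (b * a powr (p - 1)) \<le> p * (b powr p / p + (a powr p - a powr p / p))"
    using assms(4) by (intro mult_left_mono) auto
  then have "p * (b * a powr (p - 1)) \<le> b powr p - a powr p + p * a powr p"
    using assms(4) by (simp add: algebra_simps)
  moreover have "a powr p = a * a powr (p - 1)"
    using assms powr_add[of a 1 "p - 1"] by simp
  ultimately have "a powr p - b powr p \<le> p * a powr (p - 1) * (a - b)"
    by (simp add: algebra_simps)
  also have "\<dots> \<le> p * a powr (p - 1) * \<bar>a - b\<bar>" using assms(4) by (intro mult_left_mono) auto
  also have "\<dots> \<le> p * B powr (p - 1) * \<bar>a - b\<bar>"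
    using assms by (intro mult_right_mono mult_left_mono powr_mono2) auto
  finally show ?thesis .
qed

text \<open>
  The approximating polynomials are truncated to \<open>[0, B]\<close>, which brings them no further from \<open>f\<close>, so that
  the power \<open>\<alpha>\<close> is Lipschitz on all values that occur and \<open>L\<^sup>1\<close>-convergence passes through it.
\<close>

lemma shift_inequality_borel:
  fixes \<mu> :: "'a::{real_inner, second_countable_topology} measure"
  assumes \<mu>: "borel_prob \<mu>" "gaussian_split \<mu> v"
    and f: "f \<in> borel_measurable borel" "\<And>x. 0 \<le> f x" "\<And>x. f x \<le> B"
    and \<alpha>: "\<alpha> > 1" "\<beta> > 1" "1 / \<alpha> + 1 / \<beta> = 1" and l: "l > 0"
  shows "(\<integral>x. f (x + c *\<^sub>R v) \<partial>\<mu>)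
    \<le> (\<integral>x. (l * f x) powr \<alpha> / \<alpha> \<partial>\<mu>) + (1 / l) powr \<beta> / \<beta> * exp ((\<beta>\<^sup>2 - \<beta>) * c\<^sup>2 / 2)"
proof -
  have [measurable_cong]: "sets \<mu> = sets borel" using \<mu> by (simp add: borel_prob_def)
  interpret prob_space \<mu> using \<mu> by (simp add: borel_prob_def)
  let ?N = "distr \<mu> borel (\<lambda>x. x + c *\<^sub>R v)"
  interpret N: prob_space ?N by (rule prob_space_distr) simp
  interpret two_finite_borel_measures \<mu> ?N
    by (intro two_finite_borel_measures.intro two_finite_borel_measures_axioms.intro
        finite_measure_axioms N.finite_measure_axioms) (simp_all add: \<open>sets \<mu> = sets borel\<close>)
  define E where "E = (1 / l) powr \<beta> / \<beta> * exp ((\<beta>\<^sup>2 - \<beta>) * c\<^sup>2 / 2)"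
  define \<Phi> where "\<Phi> y = (l * y) powr \<alpha> / \<alpha>" for y
  have B: "0 \<le> B" using f order_trans by blast
  define L where "L = (l * B) powr (\<alpha> - 1) * l"
  have bb: "bounded_borel f" using f by (intro bounded_borelI[of _ B]) auto
  obtain p where p: "\<And>n. trig_poly (p n)" "(\<lambda>n. \<integral>x. \<bar>f x - p n x\<bar> \<partial>\<mu>) \<longlonglongrightarrow> 0"
      "(\<lambda>n. \<integral>x. \<bar>f x - p n x\<bar> \<partial>?N) \<longlonglongrightarrow> 0"
    using trig_approx_sequence[OF bb f(2)] by blast
  define \<phi> where "\<phi> y = min B (max 0 y)" for y :: real
  have \<phi>: "continuous_on UNIV \<phi>" "\<And>y. 0 \<le> \<phi> y" "\<And>y. \<phi> y \<le> B"
    using B by (auto simp: \<phi>_def[abs_def] intro!: continuous_intros)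
  have \<phi>_diff: "\<bar>f x - \<phi> (p n x)\<bar> \<le> \<bar>f x - p n x\<bar>" for n x
    using f(2,3)[of x] by (auto simp: \<phi>_def min_def max_def)
  have \<Phi>_diff: "\<Phi> (\<phi> (p n x)) \<le> \<Phi> (f x) + L * \<bar>f x - p n x\<bar>" for n x
  proof -
    have "(l * \<phi> (p n x)) powr \<alpha> - (l * f x) powr \<alpha> \<le> \<alpha> * (l * B) powr (\<alpha> - 1) * \<bar>l * \<phi> (p n x) - l * f x\<bar>"
      using l \<phi> f \<alpha> by (intro powr_diff_le) auto
    also have "\<bar>l * \<phi> (p n x) - l * f x\<bar> = l * \<bar>f x - \<phi> (p n x)\<bar>"
      using l by (simp add: abs_mult abs_minus_commute flip: right_diff_distrib)
    also have "\<alpha> * (l * B) powr (\<alpha> - 1) * (l * \<bar>f x - \<phi> (p n x)\<bar>) \<le> \<alpha> * (l * B) powr (\<alpha> - 1) * (l * \<bar>f x - p n x\<bar>)"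
      using l \<alpha> \<phi>_diff by (intro mult_left_mono) auto
    finally show ?thesis using \<alpha> by (simp add: \<Phi>_def L_def field_simps)
  qed
  have [measurable]: "f \<in> borel_measurable borel" "p n \<in> borel_measurable borel" "\<phi> \<in> borel_measurable borel" for n
    using f p(1) \<phi>(1) by (auto intro: trig_poly_measurable borel_measurable_continuous_onI)
  have [measurable]: "\<Phi> \<in> borel_measurable borel" unfolding \<Phi>_def[abs_def] by measurable
  have bp: "bounded_borel (p n)" for n by (rule bounded_borel_trig_poly[OF p(1)])
  have \<Phi>b: "bounded_borel (\<lambda>x. \<Phi> (g x))"
    if "g \<in> borel_measurable borel" "\<And>x. 0 \<le> g x" "\<And>x. g x \<le> B" for g :: "'a \<Rightarrow> real"
    using that l \<alpha> by (intro bounded_borelI[of _ "\<Phi> B"]) (auto simp: \<Phi>_def intro!: divide_right_mono powr_mono2)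
  note int = integrable_bounded_borel[OF bb] integrable_bounded_borel[OF bp]
    integrable_bounded_borel[OF \<Phi>b[OF f]]
  have key: "(\<integral>x. f x \<partial>?N) \<le> ((\<integral>x. \<Phi> (f x) \<partial>\<mu>) + L * (\<integral>x. \<bar>f x - p n x\<bar> \<partial>\<mu>) + E) + (\<integral>x. \<bar>f x - p n x\<bar> \<partial>?N)" for n
  proof -
    have b\<phi>: "bounded_borel (\<lambda>x. \<phi> (p n x))" using \<phi> by (intro bounded_borelI[of _ B]) auto
    have b\<Phi>: "bounded_borel (\<lambda>x. \<Phi> (\<phi> (p n x)))" using \<phi> by (intro \<Phi>b) auto
    note int' = int integrable_bounded_borel[OF b\<phi>] integrable_bounded_borel[OF b\<Phi>]
    have "(\<integral>x. f x \<partial>?N) \<le> (\<integral>x. \<phi> (p n x) + \<bar>f x - p n x\<bar> \<partial>?N)"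
    proof (rule integral_mono)
      show "f x \<le> \<phi> (p n x) + \<bar>f x - p n x\<bar>" for x using \<phi>_diff[of x n] by linarith
    qed (use int' in auto)
    also have "\<dots> = (\<integral>x. \<phi> (p n x) \<partial>?N) + (\<integral>x. \<bar>f x - p n x\<bar> \<partial>?N)" using int' by simp
    also have "(\<integral>x. \<phi> (p n x) \<partial>?N) = (\<integral>x. \<phi> (p n (x + c *\<^sub>R v)) \<partial>\<mu>)"
      by (intro integral_distr) auto
    also have "\<dots> \<le> (\<integral>x. \<Phi> (\<phi> (p n x)) \<partial>\<mu>) + E"
      unfolding \<Phi>_def E_def by (rule shift_inequality_continuous[OF \<mu> p(1) \<phi>(1,2) \<alpha> l])
    also have "(\<integral>x. \<Phi> (\<phi> (p n x)) \<partial>\<mu>) \<le> (\<integral>x. \<Phi> (f x) + L * \<bar>f x - p n x\<bar> \<partial>\<mu>)"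
      using int' by (intro integral_mono \<Phi>_diff) auto
    also have "\<dots> = (\<integral>x. \<Phi> (f x) \<partial>\<mu>) + L * (\<integral>x. \<bar>f x - p n x\<bar> \<partial>\<mu>)" using int' by simp
    finally show ?thesis by simp
  qed
  have "(\<lambda>n. ((\<integral>x. \<Phi> (f x) \<partial>\<mu>) + L * (\<integral>x. \<bar>f x - p n x\<bar> \<partial>\<mu>) + E) + (\<integral>x. \<bar>f x - p n x\<bar> \<partial>?N))
      \<longlonglongrightarrow> ((\<integral>x. \<Phi> (f x) \<partial>\<mu>) + L * 0 + E) + 0"
    by (intro tendsto_intros p)
  from LIMSEQ_le_const[OF this, of "\<integral>x. f x \<partial>?N"] key
  have "(\<integral>x. f x \<partial>?N) \<le> (\<integral>x. \<Phi> (f x) \<partial>\<mu>) + E" by auto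
  also have "(\<integral>x. f x \<partial>?N) = (\<integral>x. f (x + c *\<^sub>R v) \<partial>\<mu>)" by (intro integral_distr) auto
  finally show ?thesis by (simp add: \<Phi>_def E_def)
qed

text \<open>
  With \<open>J\<close> for the left integral and \<open>D = \<integral> \<rho>\<^sup>\<beta>\<close>, the choice of \<open>l\<close> with \<open>l\<^sup>-\<^sup>\<beta> D = J\<close>
  turns \<open>J \<le> l\<^sup>\<alpha> A / \<alpha> + l\<^sup>-\<^sup>\<beta> D / \<beta>\<close> into \<open>J\<^sup>\<alpha> \<le> A D\<^sup>\<alpha>\<^sup>-\<^sup>1\<close>. Choosing \<open>l\<close> in terms of \<open>J\<close> and not of
  \<open>A\<close> leaves \<open>J = 0\<close> as the only degenerate case, which is trivial.
\<close>

lemma gaussian_split_harnack: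
  fixes \<mu> :: "'a::{real_inner, second_countable_topology} measure"
  assumes \<mu>: "borel_prob \<mu>" "gaussian_split \<mu> v"
    and f: "f \<in> borel_measurable borel" "\<And>x. 0 \<le> f x" "\<And>x. f x \<le> B"
    and \<alpha>: "\<alpha> > 1"
  shows "(\<integral>x. f (x + c *\<^sub>R v) \<partial>\<mu>) powr \<alpha> \<le> (\<integral>x. f x powr \<alpha> \<partial>\<mu>) * exp (\<alpha> / (2 * (\<alpha> - 1)) * c\<^sup>2)"
proof -
  define J A where "J = (\<integral>x. f (x + c *\<^sub>R v) \<partial>\<mu>)" and "A = (\<integral>x. f x powr \<alpha> \<partial>\<mu>)"
  define \<beta> where "\<beta> = \<alpha> / (\<alpha> - 1)"
  have \<beta>: "\<beta> > 1" "1 / \<alpha> + 1 / \<beta> = 1" using \<alpha> by (auto simp: \<beta>_def field_simps)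
  define D where "D = exp ((\<beta>\<^sup>2 - \<beta>) * c\<^sup>2 / 2)"
  have D: "0 < D" by (simp add: D_def)
  have J0: "0 \<le> J" and A0: "0 \<le> A" using f by (auto simp: J_def A_def)
  have exponent: "(\<alpha> - 1) * ((\<beta>\<^sup>2 - \<beta>) * c\<^sup>2 / 2) = \<alpha> / (2 * (\<alpha> - 1)) * c\<^sup>2"
  proof -
    have "\<alpha> - 1 \<noteq> 0" using \<alpha> by simp
    moreover have "\<beta>\<^sup>2 - \<beta> = \<alpha> / (\<alpha> - 1)\<^sup>2"
    proof -
      have "\<beta> - 1 = 1 / (\<alpha> - 1)" using \<alpha> by (simp add: \<beta>_def field_simps)
      moreover have "\<beta>\<^sup>2 - \<beta> = \<beta> * (\<beta> - 1)" by (simp add: power2_eq_square right_diff_distrib)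
      ultimately show ?thesis by (simp add: \<beta>_def power2_eq_square)
    qed
    ultimately show ?thesis by (simp add: power2_eq_square)
  qed
  show ?thesis
  proof (cases "J = 0")
    case True
    then show ?thesis using A0 by (simp add: J_def[symmetric] A_def[symmetric])
  next
    case False
    then have J: "0 < J" using J0 by simp
    \<comment> \<open>the solution of \<open>l\<^sup>-\<^sup>\<beta> D = J\<close>\<close>
    define l where "l = (D / J) powr (1 / \<beta>)"
    have l: "0 < l" using D J by (simp add: l_def)
    have lb: "(1 / l) powr \<beta> * D = J"
      using D J \<beta> by (simp add: l_def powr_divide powr_powr)
    have "\<alpha> / \<beta> = \<alpha> - 1" using \<alpha> by (simp add: \<beta>_def)
    then have la: "l powr \<alpha> = (D / J) powr (\<alpha> - 1)"
      by (simp add: l_def powr_powr)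
    have "J \<le> (\<integral>x. (l * f x) powr \<alpha> / \<alpha> \<partial>\<mu>) + (1 / l) powr \<beta> / \<beta> * D"
      unfolding J_def D_def by (rule shift_inequality_borel[OF \<mu> f \<alpha> \<beta> l])
    also have "(\<integral>x. (l * f x) powr \<alpha> / \<alpha> \<partial>\<mu>) = l powr \<alpha> * A / \<alpha>"
      using l f(2) by (simp add: A_def powr_mult)
    also have "(1 / l) powr \<beta> / \<beta> * D = J / \<beta>" using lb by simp
    finally have "J * (1 - 1 / \<beta>) \<le> l powr \<alpha> * A / \<alpha>" by (simp add: algebra_simps)
    moreover have "1 - 1 / \<beta> = 1 / \<alpha>" using \<beta>(2) by simp
    ultimately have "J \<le> (D / J) powr (\<alpha> - 1) * A" using \<alpha> by (simp add: la field_simps)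
    then have "J * J powr (\<alpha> - 1) \<le> ((D / J) powr (\<alpha> - 1) * A) * J powr (\<alpha> - 1)"
      by (intro mult_right_mono) auto
    also have "J * J powr (\<alpha> - 1) = J powr \<alpha>" using J powr_add[of J 1 "\<alpha> - 1"] by simp
    also have "((D / J) powr (\<alpha> - 1) * A) * J powr (\<alpha> - 1) = A * D powr (\<alpha> - 1)"
      using D J by (simp add: powr_divide)
    also have "D powr (\<alpha> - 1) = exp (\<alpha> / (2 * (\<alpha> - 1)) * c\<^sup>2)"
      unfolding D_def exp_powr_real exponent[symmetric] by (simp add: mult.commute)
    finally show ?thesis by (simp add: J_def A_def)
  qed
qed

text \<open>
  With \<open>S = R\<^sup>1\<^sup>/\<^sup>2\<close> and \<open>e\<close> the direction of \<open>k\<close>, the quadratic form splits by Pythagoras as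
  \<open>\<langle>R \<xi>, \<xi>\<rangle> = \<bar>S \<xi>\<bar>\<^sup>2 = \<bar>T \<xi>\<bar>\<^sup>2 + \<langle>S \<xi>, e\<rangle>\<^sup>2\<close>, where \<open>T \<xi>\<close> is the part of \<open>S \<xi>\<close> orthogonal to \<open>e\<close>.
  Since \<open>sgn 0 = 0\<close>, the case \<open>k = 0\<close> is the trivial splitting along the zero vector.
\<close>

lemma has_triplet_gaussian_split:
  fixes \<mu> :: "'a::{real_inner, banach, second_countable_topology} measure"
  assumes trip: "has_triplet \<mu> a R m"
  shows "gaussian_split \<mu> (op_sqrt R (sgn k))"
proof -
  have m: "levy_measure m" and R: "nonneg_symmetric R"
    and ch: "(\<integral>x. exp (\<i> * complex_of_real (x \<bullet> \<xi>)) \<partial>\<mu>) = exp (- levy_exponent a R m \<xi>)" for \<xi>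
    using trip by (auto simp: has_triplet_def nonneg_symmetric_trace_class_def)
  define S where "S = op_sqrt R"
  have S: "S x \<bullet> y = x \<bullet> S y" "S (S x) = R x" for x y
    using nonneg_symmetric_op_sqrt[OF R] op_sqrt_square[OF R] by (auto simp: S_def nonneg_symmetric_def)
  define e where "e = sgn k"
  define T where "T \<xi> = S \<xi> - (S \<xi> \<bullet> e) *\<^sub>R e" for \<xi>
  have adj: "T \<xi> \<bullet> c = \<xi> \<bullet> S (c - (c \<bullet> e) *\<^sub>R e)" for \<xi> c
    unfolding S(1)[symmetric] T_def inner_diff_left inner_diff_right
    by (simp add: inner_commute[of e c])
  have split: "R \<xi> \<bullet> \<xi> = (norm (T \<xi>))\<^sup>2 + (\<xi> \<bullet> S e)\<^sup>2" for \<xi>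
  proof -
    define d where "d = S \<xi> \<bullet> e"
    have "d * d * (e \<bullet> e) = d * d"
    proof (cases "k = 0")
      case False
      then have "e \<bullet> e = 1" by (simp add: e_def dot_square_norm norm_sgn)
      then show ?thesis by simp
    qed (simp add: d_def e_def)
    then have "(norm (T \<xi>))\<^sup>2 = S \<xi> \<bullet> S \<xi> - d * d"
      unfolding power2_norm_eq_inner T_def d_def[symmetric] inner_diff_left inner_diff_right
        inner_scaleR_left inner_scaleR_right inner_commute[of e "S \<xi>"] by simp
    moreover have "R \<xi> \<bullet> \<xi> = S \<xi> \<bullet> S \<xi>" using S(1)[of "S \<xi>" \<xi>] by (simp add: S(2))
    moreover have "\<xi> \<bullet> S e = d" using S(1)[of \<xi> e] by (simp add: d_def)
    ultimately show ?thesis by (simp add: power2_eq_square)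
  qed
  let ?\<phi> = "\<lambda>\<xi>. character a \<xi> * (complex_of_real (exp (- (norm (T \<xi>))\<^sup>2 / 2)) * exp (\<integral>x. levy_integrand \<xi> x \<partial>m))"
  have "trig_positive ?\<phi>"
    by (intro trig_positive_mult trig_positive_character trig_positive_gaussian[OF adj] trig_positive_levy m)
  moreover have "(\<integral>x. character x \<xi> \<partial>\<mu>) = ?\<phi> \<xi> * complex_of_real (exp (- (\<xi> \<bullet> S e)\<^sup>2 / 2))" for \<xi>
  proof -
    have "(\<integral>x. character x \<xi> \<partial>\<mu>) = exp (- levy_exponent a R m \<xi>)"
      using ch[of \<xi>] by (simp add: character_def inner_commute)
    also have "- levy_exponent a R m \<xi> = \<i> * complex_of_real (\<xi> \<bullet> a)
        + (complex_of_real (- (norm (T \<xi>))\<^sup>2 / 2) + (\<integral>x. levy_integrand \<xi> x \<partial>m))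
        + complex_of_real (- (\<xi> \<bullet> S e)\<^sup>2 / 2)"
      by (simp add: levy_exponent_def levy_integrand_def split inner_commute[of a] field_simps)
    finally show ?thesis by (simp only: exp_add character_def exp_of_real mult_ac)
  qed
  ultimately show ?thesis unfolding gaussian_split_def S_def e_def by blast
qed

lemma has_triplet_harnack:
  fixes \<mu> :: "'a::{real_inner, banach, second_countable_topology} measure"
  assumes trip: "has_triplet \<mu> a R m" and h: "h \<in> range (op_sqrt R)"
    and f: "f \<in> borel_measurable borel" "\<And>x. 0 \<le> f x" "\<And>x. f x \<le> B" and \<alpha>: "\<alpha> > 1"
  shows "(\<integral>x. f (x + h) \<partial>\<mu>) powr \<alpha>
    \<le> (\<integral>x. f x powr \<alpha> \<partial>\<mu>) * exp (\<alpha> / (2 * (\<alpha> - 1)) * (norm (pseudo_inverse (op_sqrt R) h))\<^sup>2)"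
proof -
  let ?k = "pseudo_inverse (op_sqrt R) h"
  have "borel_prob \<mu>" using trip by (simp add: has_triplet_def infinitely_divisible_def)
  moreover have "h = norm ?k *\<^sub>R op_sqrt R (sgn ?k)"
  proof -
    have "norm ?k *\<^sub>R sgn ?k = ?k" by (cases "?k = 0") (simp_all add: sgn_div_norm)
    then show ?thesis using pseudo_inverse_eq[OF h] by (metis blinfun.scaleR_right)
  qed
  ultimately show ?thesis
    using gaussian_split_harnack[OF _ has_triplet_gaussian_split[OF trip, of ?k] f \<alpha>, of "norm ?k"] by simp
qed

section \<open>Integration of the Harnack inequality\<close>

text \<open>
  Arbitrary integrands are admitted in view of those built from the extended-real norm \<open>\<bar>\<Gamma> x\<bar>\<close>. The
  inequality is inherited from the simple minorants whose supremum defines the integral.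
\<close>

lemma nn_integral_cmult_le:
  fixes c :: ennreal
  shows "c * (\<integral>\<^sup>+x. f x \<partial>M) \<le> (\<integral>\<^sup>+x. c * f x \<partial>M)"
proof -
  have "c * (\<integral>\<^sup>+x. f x \<partial>M) = (SUP g\<in>{g. simple_function M g \<and> g \<le> f}. c * integral\<^sup>S M g)"
    unfolding nn_integral_def by (rule SUP_mult_left_ennreal)
  also have "\<dots> \<le> (\<integral>\<^sup>+x. c * f x \<partial>M)"
  proof (rule SUP_least)
    fix g assume g: "g \<in> {g. simple_function M g \<and> g \<le> f}"
    then have "c * integral\<^sup>S M g = (\<integral>\<^sup>Sx. c * g x \<partial>M)" by (simp add: simple_integral_mult)
    also have "\<dots> = (\<integral>\<^sup>+x. c * g x \<partial>M)"
      using g by (intro nn_integral_eq_simple_integral[symmetric]) auto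
    also have "\<dots> \<le> (\<integral>\<^sup>+x. c * f x \<partial>M)"
      using g by (intro nn_integral_mono mult_left_mono) (auto simp: le_fun_def)
    finally show "c * integral\<^sup>S M g \<le> (\<integral>\<^sup>+x. c * f x \<partial>M)" .
  qed
  finally show ?thesis .
qed

text \<open>
  Follows from the preceding inequality with the factor \<open>1 / K\<close>, which is why \<open>K\<close> is positive and
  finite.
\<close>

lemma nn_integral_cmult_pos_real:
  assumes "0 < K"
  shows "(\<integral>\<^sup>+x. ennreal K * f x \<partial>M) \<le> ennreal K * (\<integral>\<^sup>+x. f x \<partial>M)"
proof -
  have inv: "ennreal (1 / K) * (ennreal K * z) = z" "ennreal K * (ennreal (1 / K) * z) = z" for z
    using assms by (simp_all add: mult.assoc[symmetric] flip: ennreal_mult)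
  have "ennreal (1 / K) * (\<integral>\<^sup>+x. ennreal K * f x \<partial>M) \<le> (\<integral>\<^sup>+x. f x \<partial>M)"
    using nn_integral_cmult_le[of "ennreal (1 / K)" M "\<lambda>x. ennreal K * f x"] by (simp add: inv)
  then have "ennreal K * (ennreal (1 / K) * (\<integral>\<^sup>+x. ennreal K * f x \<partial>M)) \<le> ennreal K * (\<integral>\<^sup>+x. f x \<partial>M)"
    by (rule mult_left_mono) simp
  then show ?thesis by (simp add: inv)
qed

lemma epowr_mono: "x \<le> y \<Longrightarrow> 0 \<le> p \<Longrightarrow> epowr x p \<le> epowr y p"
  by (auto simp: epowr_def top_unique less_top intro!: ennreal_leI powr_mono2 enn2real_mono)

lemma epowr_ennreal: "0 \<le> r \<Longrightarrow> epowr (ennreal r) p = ennreal (r powr p)"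
  by (simp add: epowr_def)

lemma epowr_mult_ennreal:
  assumes "x \<noteq> \<infinity>" "0 \<le> r"
  shows "epowr (x * ennreal r) p = epowr x p * ennreal (r powr p)"
  using assms by (cases x) (auto simp: epowr_ennreal powr_mult simp flip: ennreal_mult)

lemma trans_op_measurable:
  fixes U :: "real \<Rightarrow> real \<Rightarrow> ('a::{real_normed_vector, second_countable_topology} \<Rightarrow>\<^sub>L 'a)"
  assumes "borel_prob (\<mu> t s)" "f \<in> borel_measurable borel"
  shows "trans_op U \<mu> s t f \<in> borel_measurable borel"
proof -
  have [measurable_cong]: "sets (\<mu> t s) = sets borel" and [measurable]: "f \<in> borel_measurable borel"
    using assms by (auto simp: borel_prob_def)
  interpret prob_space "\<mu> t s" using assms by (simp add: borel_prob_def)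
  have [measurable]: "blinfun_apply (U t s) \<in> borel_measurable borel"
    by (intro borel_measurable_continuous_onI continuous_intros)
  have [measurable]: "snd \<in> borel_measurable (borel \<Otimes>\<^sub>M \<mu> t s)"
    using measurable_snd[of borel "\<mu> t s"]
    by (simp only: measurable_cong_sets[OF refl \<open>sets (\<mu> t s) = sets borel\<close>])
  show ?thesis unfolding trans_op_def[abs_def] by measurable
qed

lemma trans_op_bounded:
  fixes U :: "real \<Rightarrow> real \<Rightarrow> ('a::{real_normed_vector, second_countable_topology} \<Rightarrow>\<^sub>L 'a)"
  assumes "borel_prob (\<mu> t s)" and f: "f \<in> borel_measurable borel" "\<And>x. 0 \<le> f x" "\<And>x. f x \<le> B"
  shows "0 \<le> trans_op U \<mu> s t f x" "trans_op U \<mu> s t f x \<le> B"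
proof -
  have [measurable_cong]: "sets (\<mu> t s) = sets borel" using assms by (auto simp: borel_prob_def)
  interpret prob_space "\<mu> t s" using assms by (simp add: borel_prob_def)
  show "0 \<le> trans_op U \<mu> s t f x" using f by (simp add: trans_op_def)
  have "trans_op U \<mu> s t f x \<le> (\<integral>y. B \<partial>\<mu> t s)"
    unfolding trans_op_def using f order_trans[OF f(2,3)]
    by (intro integral_mono integrable_const_bound[of _ B]) auto
  then show "trans_op U \<mu> s t f x \<le> B" by (simp add: prob_space)
qed

text \<open>
  Writing \<open>U x + z = U y + (z + U (x - y))\<close>, this is the inequality for translates applied to
  \<open>z \<mapsto> f (U y + z)\<close>. Outside the range of \<open>R\<^sup>1\<^sup>/\<^sup>2\<close> the left-hand side vanishes.
\<close>

lemma trans_op_harnack: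
  fixes U R :: "real \<Rightarrow> real \<Rightarrow> ('a::{real_inner, banach, second_countable_topology} \<Rightarrow>\<^sub>L 'a)"
  assumes trip: "has_triplet (\<mu> t s) a (R t s) m"
    and f: "f \<in> borel_measurable borel" "\<And>x. 0 \<le> f x" "\<And>x. f x \<le> B" and \<alpha>: "\<alpha> > 1"
  shows "ennreal (trans_op U \<mu> s t f x powr \<alpha>)
      * exp_neg (ennreal (\<alpha> / (2 * (\<alpha> - 1))) * (Gamma_norm (U t s) (R t s) (x - y))\<^sup>2)
    \<le> ennreal (trans_op U \<mu> s t (\<lambda>z. f z powr \<alpha>) y)"
proof -
  define \<kappa> where "\<kappa> = \<alpha> / (2 * (\<alpha> - 1))"
  have \<kappa>: "0 < \<kappa>" using \<alpha> by (simp add: \<kappa>_def)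
  let ?S = "op_sqrt (R t s)" and ?h = "U t s (x - y)"
  show ?thesis
  proof (cases "?h \<in> range ?S")
    case False
    then show ?thesis unfolding \<kappa>_def[symmetric]
      using \<kappa> by (simp add: Gamma_norm_def exp_neg_def ennreal_mult_top)
  next
    case True
    define n where "n = norm (pseudo_inverse ?S ?h)"
    define J A where "J = trans_op U \<mu> s t f x" and "A = trans_op U \<mu> s t (\<lambda>z. f z powr \<alpha>) y"
    have "J powr \<alpha> \<le> A * exp (\<kappa> * n\<^sup>2)"
    proof -
      have eq: "U t s y + (z + ?h) = U t s x + z" for z by (simp add: blinfun.diff_right)
      have meas: "(\<lambda>z. f (U t s y + z)) \<in> borel_measurable borel" using f(1) by measurable
      from has_triplet_harnack[OF trip True meas f(2,3) \<alpha>] show ?thesis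
        by (simp only: eq J_def A_def trans_op_def \<kappa>_def n_def)
    qed
    then have "J powr \<alpha> * exp (- (\<kappa> * n\<^sup>2)) \<le> A" by (simp add: exp_minus field_simps)
    moreover have "exp_neg (ennreal \<kappa> * (Gamma_norm (U t s) (R t s) (x - y))\<^sup>2) = ennreal (exp (- (\<kappa> * n\<^sup>2)))"
    proof -
      have "ennreal \<kappa> * (Gamma_norm (U t s) (R t s) (x - y))\<^sup>2 = ennreal (\<kappa> * n\<^sup>2)"
        using True \<kappa> by (simp add: Gamma_norm_def n_def ennreal_mult ennreal_power)
      then show ?thesis using \<kappa> by (simp add: exp_neg_def)
    qed
    ultimately show ?thesis unfolding \<kappa>_def[symmetric] J_def[symmetric] A_def[symmetric]
      by (simp add: ennreal_leI flip: ennreal_mult)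
  qed
qed

lemma exp_neg_le_1: "exp_neg c \<le> 1"
  by (auto simp: exp_neg_def)

text \<open>
  The case \<open>I = 0\<close> is where \<open>N > 0\<close> matters: the right-hand side is then infinite.
\<close>

lemma le_inverse_epowr_mult:
  assumes w: "0 \<le> w" and N: "0 < N" and I: "I \<le> 1" and p: "0 < p"
    and le: "ennreal w * I \<le> ennreal N"
  shows "ennreal (w powr p) \<le> ennreal (N powr p) * inverse (epowr I p)"
proof (cases "I = 0")
  case True
  then show ?thesis using N by (simp add: epowr_def ennreal_mult_top)
next
  case False
  obtain r where r: "I = ennreal r" "0 < r"
    using I False by (cases I) (auto simp: top_unique)
  then have "w * r \<le> N" using le w N by (simp flip: ennreal_mult)
  then have "(w * r) powr p \<le> N powr p" using w r p by (intro powr_mono2) auto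
  then have "w powr p \<le> N powr p * inverse (r powr p)"
    using w r by (simp add: powr_mult field_simps)
  then have "ennreal (w powr p) \<le> ennreal (N powr p * inverse (r powr p))" by (rule ennreal_leI)
  then show ?thesis using r by (simp add: epowr_ennreal inverse_ennreal ennreal_mult)
qed

theorem theorem5p8:
  fixes U R :: "real \<Rightarrow> real \<Rightarrow>
      ('a::{real_inner, banach, second_countable_topology} \<Rightarrow>\<^sub>L 'a)"
    and \<mu> m :: "real \<Rightarrow> real \<Rightarrow> 'a measure"
    and a :: "real \<Rightarrow> real \<Rightarrow> 'a"
    and \<nu> :: "real \<Rightarrow> 'a measure"
    and s t \<alpha> \<epsilon> :: real
    and f :: "'a \<Rightarrow> real"
  assumes "evolution_family U"
    and "\<And>s t. s \<le> t \<Longrightarrow> has_triplet (\<mu> t s) (a t s) (R t s) (m t s)"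
    and "\<And>s r t. s \<le> r \<Longrightarrow> r \<le> t \<Longrightarrow>
           \<mu> t s = conv (\<mu> t r) (distr (\<mu> r s) borel (blinfun_apply (U t r)))"
    and "evolution_system_of_measures (trans_op U \<mu>) \<nu>"
    and "s \<le> t" and "\<alpha> > 1" and "\<epsilon> > 0"
    and "f \<in> borel_measurable borel" and "bounded (range f)"
  shows "Lp_norm (\<alpha> * (1 + \<epsilon>)) (\<nu> s) (trans_op U \<mu> s t f)
       \<le> (if C_const U R \<nu> s t \<alpha> \<epsilon> = \<infinity> then \<infinity>
          else epowr (C_const U R \<nu> s t \<alpha> \<epsilon>) (1 / (\<alpha> * (1 + \<epsilon>))) * Lp_norm \<alpha> (\<nu> t) f)"
proof -
  note trip = assms(2)[OF \<open>s \<le> t\<close>]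
  have \<mu>: "borel_prob (\<mu> t s)" using trip by (simp add: has_triplet_def infinitely_divisible_def)
  interpret \<mu>: prob_space "\<mu> t s" using \<mu> by (simp add: borel_prob_def)
  have [measurable_cong]: "sets (\<mu> t s) = sets borel" using \<mu> by (simp add: borel_prob_def)
  have \<nu>: "borel_prob (\<nu> r)" for r using assms(4) by (simp add: evolution_system_of_measures_def)
  interpret \<nu>s: prob_space "\<nu> s" using \<nu> by (simp add: borel_prob_def)
  interpret \<nu>t: prob_space "\<nu> t" using \<nu> by (simp add: borel_prob_def)
  have [measurable_cong]: "sets (\<nu> r) = sets borel" for r using \<nu> by (simp add: borel_prob_def)
  have [measurable]: "f \<in> borel_measurable borel" by fact
  have inv: "(\<integral>x. trans_op U \<mu> s t g x \<partial>\<nu> s) = (\<integral>x. g x \<partial>\<nu> t)"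
    if "g \<in> borel_measurable borel" "bounded (range g)" for g
    using assms(4) \<open>s \<le> t\<close> that by (auto simp: evolution_system_of_measures_def)
  obtain B where B: "\<And>x. \<bar>f x\<bar> \<le> B" using \<open>bounded (range f)\<close> by (auto simp: bounded_iff)
  let ?P = "trans_op U \<mu> s t"
  define q where "q = \<alpha> * (1 + \<epsilon>)"
  have q: "0 < q" using assms(6,7) by (simp add: q_def)
  define N where "N = (\<integral>x. \<bar>f x\<bar> powr \<alpha> \<partial>\<nu> t)"
  have N0: "0 \<le> N" by (simp add: N_def)
  have abs: "(\<lambda>x. \<bar>f x\<bar>) \<in> borel_measurable borel" "\<And>x. 0 \<le> \<bar>f x\<bar>" "\<And>x. \<bar>f x\<bar> \<le> B" using B by auto
  have pow: "(\<lambda>x. \<bar>f x\<bar> powr \<alpha>) \<in> borel_measurable borel" "\<And>x. 0 \<le> \<bar>f x\<bar> powr \<alpha>" "\<And>x. \<bar>f x\<bar> powr \<alpha> \<le> B powr \<alpha>"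
    using B assms(6) by (auto intro!: powr_mono2)
  have abs_le: "\<bar>?P f x\<bar> \<le> ?P (\<lambda>x. \<bar>f x\<bar>) x" for x
    unfolding trans_op_def by (rule integral_abs_bound)
  have int_pow: "integrable (\<nu> t) (\<lambda>x. \<bar>f x\<bar> powr \<alpha>)"
    by (rule \<nu>t.integrable_const_bound[of _ "B powr \<alpha>"]) (use pow in auto)
  have RHS: "Lp_norm \<alpha> (\<nu> t) f = ennreal (N powr (1 / \<alpha>))"
    unfolding Lp_norm_def N_def using int_pow by (subst nn_integral_eq_integral) (auto intro: epowr_ennreal)
  show ?thesis
  proof (cases "C_const U R \<nu> s t \<alpha> \<epsilon> = \<infinity>")
    case True
    then show ?thesis by simp
  next
    case False
    define C where "C = C_const U R \<nu> s t \<alpha> \<epsilon>"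
    have C: "C \<noteq> \<infinity>" using False by (simp add: C_def)
    have bound: "(\<integral>\<^sup>+x. ennreal (\<bar>?P f x\<bar> powr q) \<partial>\<nu> s) \<le> C * ennreal (N powr (1 + \<epsilon>))"
    \<comment> \<open>the pointwise bound by \<open>N / I x\<close> can fail where \<open>N = I x = 0\<close>, as \<open>0 * \<infinity> = 0\<close>; if \<open>N = 0\<close>, then \<open>f\<close> and, by invariance, \<open>p \<bar>f\<bar>\<close> vanish almost everywhere\<close>
    proof (cases "N = 0")
      case True
      have "AE x in \<nu> t. \<bar>f x\<bar> powr \<alpha> = 0"
        using True integral_nonneg_eq_0_iff_AE[OF int_pow] by (simp add: N_def)
      then have "(\<integral>x. \<bar>f x\<bar> \<partial>\<nu> t) = (\<integral>x. 0 \<partial>\<nu> t)"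
        by (intro integral_cong_AE) auto
      then have "(\<integral>x. ?P (\<lambda>x. \<bar>f x\<bar>) x \<partial>\<nu> s) = 0"
        using inv[OF abs(1)] B by (simp add: bounded_iff) blast
      moreover have "integrable (\<nu> s) (?P (\<lambda>x. \<bar>f x\<bar>))"
        using trans_op_bounded[where f="\<lambda>x. \<bar>f x\<bar>" and B=B and \<mu>=\<mu> and t=t and s=s, OF \<mu> abs] trans_op_measurable[where \<mu>=\<mu> and t=t and s=s, OF \<mu> abs(1)]
        by (intro \<nu>s.integrable_const_bound[of _ B]) auto
      ultimately have "AE x in \<nu> s. ?P (\<lambda>x. \<bar>f x\<bar>) x = 0"
        using integral_nonneg_eq_0_iff_AE[of "\<nu> s" "?P (\<lambda>x. \<bar>f x\<bar>)"] trans_op_bounded(1)[where f="\<lambda>x. \<bar>f x\<bar>" and B=B and \<mu>=\<mu> and t=t and s=s, OF \<mu> abs] by simp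
      then have "AE x in \<nu> s. ennreal (\<bar>?P f x\<bar> powr q) = 0"
      proof eventually_elim
        case (elim x)
        then show ?case using abs_le[of x] by simp
      qed
      then have "(\<integral>\<^sup>+x. ennreal (\<bar>?P f x\<bar> powr q) \<partial>\<nu> s) = (\<integral>\<^sup>+x. 0 \<partial>\<nu> s)"
        by (rule nn_integral_cong_AE)
      then show ?thesis by simp
    next
      case False
      then have N: "0 < N" using N0 by simp
      let ?E = "\<lambda>x y. exp_neg (ennreal (\<alpha> / (2 * (\<alpha> - 1))) * (Gamma_norm (U t s) (R t s) (x - y))\<^sup>2)"
      define I where "I x = (\<integral>\<^sup>+y. ?E x y \<partial>\<nu> s)" for x
      have I1: "I x \<le> 1" for x
      proof -
        have "I x \<le> (\<integral>\<^sup>+y. 1 \<partial>\<nu> s)" unfolding I_def by (intro nn_integral_mono exp_neg_le_1)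
        then show ?thesis by (simp add: \<nu>s.emeasure_space_1)
      qed
      have harnack: "ennreal (?P (\<lambda>x. \<bar>f x\<bar>) x powr \<alpha>) * I x \<le> ennreal N" for x
      proof -
        have "ennreal (?P (\<lambda>x. \<bar>f x\<bar>) x powr \<alpha>) * I x
            \<le> (\<integral>\<^sup>+y. ennreal (?P (\<lambda>x. \<bar>f x\<bar>) x powr \<alpha>) * ?E x y \<partial>\<nu> s)"
          unfolding I_def by (rule nn_integral_cmult_le)
        also have "\<dots> \<le> (\<integral>\<^sup>+y. ennreal (?P (\<lambda>x. \<bar>f x\<bar> powr \<alpha>) y) \<partial>\<nu> s)"
          by (intro nn_integral_mono trans_op_harnack[where f="\<lambda>x. \<bar>f x\<bar>" and B=B and \<mu>=\<mu> and t=t and s=s and R=R, OF trip abs \<open>\<alpha> > 1\<close>])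
        also have "\<dots> = ennreal (\<integral>y. ?P (\<lambda>x. \<bar>f x\<bar> powr \<alpha>) y \<partial>\<nu> s)"
          using trans_op_bounded[where f="\<lambda>x. \<bar>f x\<bar> powr \<alpha>" and B="B powr \<alpha>" and \<mu>=\<mu> and t=t and s=s, OF \<mu> pow] trans_op_measurable[where \<mu>=\<mu> and t=t and s=s, OF \<mu> pow(1)]
          by (intro nn_integral_eq_integral \<nu>s.integrable_const_bound[of _ "B powr \<alpha>"]) auto
        also have "(\<integral>y. ?P (\<lambda>x. \<bar>f x\<bar> powr \<alpha>) y \<partial>\<nu> s) = N"
          unfolding N_def using pow by (intro inv) (auto simp: bounded_iff)
        finally show ?thesis .
      qed
      have "ennreal (\<bar>?P f x\<bar> powr q) \<le> ennreal (N powr (1 + \<epsilon>)) * inverse (epowr (I x) (1 + \<epsilon>))" for x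
      proof -
        have "\<bar>?P f x\<bar> powr q \<le> ?P (\<lambda>x. \<bar>f x\<bar>) x powr q"
          using abs_le[of x] q by (intro powr_mono2) auto
        also have "\<dots> = (?P (\<lambda>x. \<bar>f x\<bar>) x powr \<alpha>) powr (1 + \<epsilon>)" by (simp add: powr_powr q_def)
        finally have "ennreal (\<bar>?P f x\<bar> powr q) \<le> ennreal ((?P (\<lambda>x. \<bar>f x\<bar>) x powr \<alpha>) powr (1 + \<epsilon>))"
          by (rule ennreal_leI)
        also have "\<dots> \<le> ennreal (N powr (1 + \<epsilon>)) * inverse (epowr (I x) (1 + \<epsilon>))"
          using N I1 harnack \<open>\<epsilon> > 0\<close> by (intro le_inverse_epowr_mult) auto
        finally show ?thesis .
      qed
      then have "(\<integral>\<^sup>+x. ennreal (\<bar>?P f x\<bar> powr q) \<partial>\<nu> s)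
          \<le> (\<integral>\<^sup>+x. ennreal (N powr (1 + \<epsilon>)) * inverse (epowr (I x) (1 + \<epsilon>)) \<partial>\<nu> s)"
        by (rule nn_integral_mono)
      also have "\<dots> \<le> ennreal (N powr (1 + \<epsilon>)) * (\<integral>\<^sup>+x. inverse (epowr (I x) (1 + \<epsilon>)) \<partial>\<nu> s)"
        using N by (intro nn_integral_cmult_pos_real) simp
      also have "\<dots> = C * ennreal (N powr (1 + \<epsilon>))" by (simp add: C_def C_const_def I_def mult.commute)
      finally show ?thesis .
    qed
    have "Lp_norm q (\<nu> s) (?P f) \<le> epowr (C * ennreal (N powr (1 + \<epsilon>))) (1 / q)"
      unfolding Lp_norm_def using q by (intro epowr_mono bound) auto
    also have "\<dots> = epowr C (1 / q) * ennreal ((N powr (1 + \<epsilon>)) powr (1 / q))"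
      using C by (intro epowr_mult_ennreal) auto
    also have "(N powr (1 + \<epsilon>)) powr (1 / q) = N powr (1 / \<alpha>)"
      using assms(7) by (simp add: powr_powr q_def)
    finally show ?thesis using False by (simp add: RHS C_def q_def)
  qed
qed

end
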